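(* Let $\beta>0$ and let $h^I:H^{-s}\to\mathbb{R}$ be a Borel function such that $e^{-\beta h^I}\in L^1(\mu_{\beta,0})$ and $h^I\in\mathbb{D}^{1,2}(\mu_{\beta,0})$. Assume furthermore that for every $\varphi\in H^s$ the function $u\mapsto\langle\nabla h^I(u),\varphi\rangle\,e^{-\beta h^I(u)}$ belongs to $L^1(\mu_{\beta,0})$. Then the Gibbs measure $$\mu_\beta=\frac{e^{-\beta h^I}\,\mu_{\beta,0}}{\int_{H^{-s}}e^{-\beta h^I}\,d\mu_{\beta,0}}$$ is a $(\beta,X)$-KMS state for the vector field $X(u)=-iAu-i\nabla h^I(u)$.
   Context: Setting. $H$ is an infinite-dimensional separable complex Hilbert space with inner product $\langle\cdot,\cdot\rangle$ antilinear in the left variable, and $\langle\cdot,\cdot\rangle_{H,\mathbb{R}}=\mathrm{Re}\langle\cdot,\cdot\rangle$. $A$ is a positive self-adjoint operator on $H$ with $A\ge c\,\mathds{1}$ for some $c>0$ and compact resolvent; $\{e_j\}_{j\ge1}$ is an orthonormal basis of $H$ with $Ae_j=\lambda_je_j$, and $f_j=ie_j$, so $\{e_j,f_j\}_j$ is an orthonormal basis of $H$ as a real Hilbert space. Fix $s\ge0$ with $\sum_j\lambda_j^{-(1+s)}<\infty$. $H^s=D(A^{s/2})$ with $\langle x,y\rangle_{H^s}=\langle A^{s/2}x,A^{s/2}y\rangle$, and $H^{-s}$ is the completion of $H$ for $\langle x,y\rangle_{H^{-s}}=\langle A^{-s/2}x,A^{-s/2}y\rangle$. $\langle\cdot,\cdot\rangle_{H,\mathbb{R}}$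 extends to the real duality pairing between $H^{-s}$ and $H^s$; we also write $\langle\cdot,\cdot\rangle$ for it when pairing gradients with vectors. Gaussian measure. $\mu_{\beta,0}$ is the centered Gaussian Borel probability measure on $H^{-s}$ with $\int e^{i\langle w,u\rangle_{H,\mathbb{R}}}d\mu_{\beta,0}(u)=e^{-\frac1{2\beta}\langle w,A^{-1}w\rangle}$ for $w\in H^s$. Cylindrical functions. $\pi_n(u)=(\langle u,e_1\rangle_{H,\mathbb{R}},\dots,\langle u,e_n\rangle_{H,\mathbb{R}};\langle u,f_1\rangle_{H,\mathbb{R}},\dots,\langle u,f_n\rangle_{H,\mathbb{R}})\in\mathbb{R}^{2n}$. $\mathscr{C}^\infty_{c,cyl}(H^{-s})$ is the set of $F=\varphi\circ\pi_n$ with $n\in\mathbb{N}$, $\varphi\in\mathscr{C}_c^\infty(\mathbb{R}^{2n})$. Let $\partial_{e_j}F,\partial_{f_j}F$ be the directional derivatives; $\nabla F=\sum_j\partial_{e_j}F\,e_j+\partial_{f_j}F\,f_j$; $\{F,G\}=\sum_j\big(\partial_{e_j}F\,\partial_{f_j}G-\partial_{e_j}G\,\partial_{f_j}F\big)$ (finite sums). Malliavin derivative. For $p\in[1,\infty)$, $\nabla$ with domain $\mathscr{C}^\infty_{c,cyl}(H^{-s})\subset L^p(\mu_{\beta,0})$ and values in $L^p(\mu_{\beta,0};H^{-s})$ is closable; $\mathbb{D}^{1,p}(\mu_{\beta,0})$ is the domain of its closure, i.e. the $F\in L^p(\mu_{\beta,0})$ for which there are $F_n\in\mathscr{C}^\infty_{c,cyl}(H^{-s})$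 with $F_n\to F$ in $L^p(\mu_{\beta,0})$ and $\nabla F_n$ convergent in $L^p(\mu_{\beta,0};H^{-s})$; the limit is denoted $\nabla F$. KMS. A Borel probability measure $\mu$ on $H^{-s}$ is a $(\beta,X)$-KMS state for $X(u)=-iAu-i\nabla h^I(u)$ if for all $F,G\in\mathscr{C}^\infty_{c,cyl}(H^{-s})$ $$\int\{F,G\}\,d\mu=\beta\int\mathrm{Re}\langle\nabla F(u),-iAu-i\nabla h^I(u)\rangle\,G(u)\,d\mu,$$ where $\mathrm{Re}\langle\nabla F(u),-iAu\rangle=\sum_j\lambda_j\big(\partial_{e_j}F\,\langle u,f_j\rangle_{H,\mathbb{R}}-\partial_{f_j}F\,\langle u,e_j\rangle_{H,\mathbb{R}}\big)$ and $\mathrm{Re}\langle\nabla F,-i\nabla h^I\rangle=\sum_j\big(\partial_{e_j}F\,\langle\nabla h^I,f_j\rangle-\partial_{f_j}F\,\langle\nabla h^I,e_j\rangle\big)$. *)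

theory Defs
  imports "HOL-Probability.Probability" "HOL-Analysis.Abstract_Euclidean_Space"
begin

section \<open>Complex Hilbert spaces\<close>

text \<open>The inner product is antilinear in the left variable. Its real part is the inner
  product \<^const>\<open>inner\<close> of the underlying real space, so the norm, the topology and real duality are
  those of the library.\<close>

class complex_inner = real_inner +
  fixes scaleC :: "complex \<Rightarrow> 'a \<Rightarrow> 'a" (infixr \<open>*\<^sub>C\<close> 75)
    and cinner :: "'a \<Rightarrow> 'a \<Rightarrow> complex"
  assumes scaleC_add_right: "a *\<^sub>C (x + y) = a *\<^sub>C x + a *\<^sub>C y"
    and scaleC_add_left: "(a + b) *\<^sub>C x = a *\<^sub>C x + b *\<^sub>C x"
    and scaleC_scaleC: "a *\<^sub>C b *\<^sub>C x = (a * b) *\<^sub>C x"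
    and scaleR_scaleC: "r *\<^sub>R x = complex_of_real r *\<^sub>C x"
    and cinner_commute: "cinner x y = cnj (cinner y x)"
    and cinner_add_right: "cinner x (y + z) = cinner x y + cinner x z"
    and cinner_scaleC_right: "cinner x (a *\<^sub>C y) = a * cinner x y"
    and inner_eq_Re_cinner: "inner x y = Re (cinner x y)"

text \<open>A (separable, complex) Hilbert space is a type of the sort below; for a metrizable topology,
  second countability is separability.\<close>

class separable_chilbert = complex_inner + complete_space + second_countable_topology

definition clinear_on :: "'a::complex_inner set \<Rightarrow> ('a \<Rightarrow> 'b::complex_inner) \<Rightarrow> bool" where
  "clinear_on D T \<longleftrightarrow>
     0 \<in> D \<and> (\<forall>x\<in>D. \<forall>y\<in>D. x + y \<in> D \<and> T (x + y) = T x + T y) \<and>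
     (\<forall>a. \<forall>x\<in>D. a *\<^sub>C x \<in> D \<and> T (a *\<^sub>C x) = a *\<^sub>C T x)"

definition orthonormal_basis :: "(nat \<Rightarrow> 'h::complex_inner) \<Rightarrow> bool" where
  "orthonormal_basis e \<longleftrightarrow>
     (\<forall>j k. cinner (e j) (e k) = (if j = k then 1 else 0)) \<and>
     closure (module.span scaleC (range e)) = UNIV"


section \<open>Unbounded operators\<close>

text \<open>An unbounded operator is a domain \<open>D\<close> together with a function \<open>A\<close> of which only the values on
  \<open>D\<close> matter. The last clause says that the graph of the adjoint is the graph of \<open>A\<close>.\<close>

definition self_adjoint :: "'h::complex_inner set \<Rightarrow> ('h \<Rightarrow> 'h) \<Rightarrow> bool" where
  "self_adjoint D A \<longleftrightarrow>
     clinear_on D A \<and> closure D = UNIV \<and>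
     (\<forall>y z. (\<forall>x\<in>D. cinner y (A x) = cinner z x) \<longleftrightarrow> y \<in> D \<and> z = A y)"

definition bounded_below :: "'h::complex_inner set \<Rightarrow> ('h \<Rightarrow> 'h) \<Rightarrow> real \<Rightarrow> bool" where
  "bounded_below D A c \<longleftrightarrow> (\<forall>x\<in>D. c * inner x x \<le> inner x (A x))"

text \<open>For some \<open>z\<close> the operator \<open>A - z\<close> is a bijection from \<open>D\<close> onto the whole space whose inverse
  maps the unit ball to a relatively compact set.\<close>

definition compact_resolvent :: "'h::complex_inner set \<Rightarrow> ('h \<Rightarrow> 'h) \<Rightarrow> bool" where
  "compact_resolvent D A \<longleftrightarrow>
     (\<exists>z. bij_betw (\<lambda>x. A x - z *\<^sub>C x) D UNIV \<and>
          compact (closure (inv_into D (\<lambda>x. A x - z *\<^sub>C x) ` cball 0 1)))"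

text \<open>The powers of the positive operator with eigenbasis \<open>e\<close> and eigenvalues \<open>lam\<close>, given by the
  spectral calculus.\<close>

definition Apow_dom :: "(nat \<Rightarrow> 'h::complex_inner) \<Rightarrow> (nat \<Rightarrow> real) \<Rightarrow> real \<Rightarrow> 'h set" where
  "Apow_dom e lam a = {x. summable (\<lambda>j. (lam j powr a * cmod (cinner (e j) x))\<^sup>2)}"

definition Apow :: "(nat \<Rightarrow> 'h::complex_inner) \<Rightarrow> (nat \<Rightarrow> real) \<Rightarrow> real \<Rightarrow> 'h \<Rightarrow> 'h" where
  "Apow e lam a x = (\<Sum>j. lam j powr a *\<^sub>R (cinner (e j) x *\<^sub>C e j))"


section \<open>The scale \<open>H\<^sup>s\<close>, \<open>H\<^sup>-\<^sup>s\<close> and the duality pairing\<close>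

definition sobolev :: "(nat \<Rightarrow> 'h::complex_inner) \<Rightarrow> (nat \<Rightarrow> real) \<Rightarrow> real \<Rightarrow> 'h set" where
  "sobolev e lam s = Apow_dom e lam (s / 2)"

text \<open>The completion \<open>H\<^sup>-\<^sup>s\<close> is any Hilbert space \<open>'k\<close> with an isometric dense embedding \<open>\<iota>\<close> of \<open>H\<close>
  equipped with the inner product \<open>\<langle>A\<^sup>-\<^sup>s\<^sup>/\<^sup>2x, A\<^sup>-\<^sup>s\<^sup>/\<^sup>2y\<rangle>\<close>.\<close>

definition neg_sobolev_completion ::
  "(nat \<Rightarrow> 'h::complex_inner) \<Rightarrow> (nat \<Rightarrow> real) \<Rightarrow> real \<Rightarrow> ('h \<Rightarrow> 'k::separable_chilbert) \<Rightarrow> bool" where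
  "neg_sobolev_completion e lam s \<iota> \<longleftrightarrow>
     clinear_on UNIV \<iota> \<and>
     (\<forall>x y. cinner (\<iota> x) (\<iota> y) = cinner (Apow e lam (- s / 2) x) (Apow e lam (- s / 2) y)) \<and>
     closure (range \<iota>) = UNIV"

text \<open>The pairing of \<open>u\<close> in \<open>H\<^sup>-\<^sup>s\<close> with \<open>w\<close> in \<open>H\<^sup>s\<close>: the functional \<open>x \<mapsto> \<langle>x, w\<rangle>\<close> on \<open>H\<close>, real inner product,
  extended by continuity. It is meaningful for \<open>w\<close> in \<open>H\<^sup>s\<close> only.\<close>

definition pairing :: "('h::complex_inner \<Rightarrow> 'k::complex_inner) \<Rightarrow> 'k \<Rightarrow> 'h \<Rightarrow> real" where
  "pairing \<iota> u w = (THE g. continuous_on UNIV g \<and> (\<forall>x. g (\<iota> x) = inner x w)) u"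


section \<open>The Gaussian measure\<close>

definition gaussian_measure ::
  "'h set \<Rightarrow> ('h \<Rightarrow> 'h) \<Rightarrow> (nat \<Rightarrow> 'h) \<Rightarrow> (nat \<Rightarrow> real) \<Rightarrow> real \<Rightarrow>
   ('h::complex_inner \<Rightarrow> 'k::separable_chilbert) \<Rightarrow> real \<Rightarrow> 'k measure \<Rightarrow> bool" where
  "gaussian_measure D A e lam s \<iota> \<beta> \<mu> \<longleftrightarrow>
     prob_space \<mu> \<and> sets \<mu> = sets borel \<and>
     (\<forall>w\<in>sobolev e lam s.
        (\<integral>u. exp (\<i> * complex_of_real (pairing \<iota> u w)) \<partial>\<mu>) =
        exp (- (1 / (2 * complex_of_real \<beta>)) * cinner w (inv_into D A w)))"


section \<open>Cylindrical functions\<close>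

text \<open>\<open>\<real>\<^sup>m\<close> with variable \<open>m\<close> is \<^term>\<open>Euclidean_space m\<close>: the real sequences that vanish from index \<open>m\<close>
  on.\<close>

definition partial_deriv :: "nat \<Rightarrow> ((nat \<Rightarrow> real) \<Rightarrow> real) \<Rightarrow> (nat \<Rightarrow> real) \<Rightarrow> real" where
  "partial_deriv i \<phi> x = deriv (\<lambda>t. \<phi> (x(i := t))) (x i)"

primrec Ck :: "nat \<Rightarrow> nat \<Rightarrow> ((nat \<Rightarrow> real) \<Rightarrow> real) \<Rightarrow> bool" where
  "Ck m 0 \<phi> \<longleftrightarrow> continuous_map (Euclidean_space m) euclideanreal \<phi>"
| "Ck m (Suc k) \<phi> \<longleftrightarrow>
     continuous_map (Euclidean_space m) euclideanreal \<phi> \<and>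
     (\<forall>i<m. (\<forall>x\<in>topspace (Euclidean_space m). (\<lambda>t. \<phi> (x(i := t))) differentiable (at (x i))) \<and>
            Ck m k (partial_deriv i \<phi>))"

definition Cc_infinity :: "nat \<Rightarrow> ((nat \<Rightarrow> real) \<Rightarrow> real) set" where
  "Cc_infinity m =
     {\<phi>. (\<forall>k. Ck m k \<phi>) \<and>
         compactin (Euclidean_space m)
           (Euclidean_space m closure_of {x \<in> topspace (Euclidean_space m). \<phi> x \<noteq> 0})}"

text \<open>Bases are indexed from \<open>0\<close>: coordinates \<open>0, \<dots>, n - 1\<close> of \<open>\<pi>\<^sub>n u\<close> pair with \<open>e\<close> and coordinates
  \<open>n, \<dots>, 2n - 1\<close> with \<open>f = \<i> e\<close>.\<close>

definition cyl_proj ::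
  "('h::complex_inner \<Rightarrow> 'k::complex_inner) \<Rightarrow> (nat \<Rightarrow> 'h) \<Rightarrow> nat \<Rightarrow> 'k \<Rightarrow> (nat \<Rightarrow> real)" where
  "cyl_proj \<iota> e n u = (\<lambda>i. if i < n then pairing \<iota> u (e i)
                          else if i < 2 * n then pairing \<iota> u (\<i> *\<^sub>C e (i - n)) else 0)"

definition Cc_cyl ::
  "('h::complex_inner \<Rightarrow> 'k::complex_inner) \<Rightarrow> (nat \<Rightarrow> 'h) \<Rightarrow> ('k \<Rightarrow> real) set" where
  "Cc_cyl \<iota> e = {F. \<exists>n. \<exists>\<phi>\<in>Cc_infinity (2 * n). F = \<phi> \<circ> cyl_proj \<iota> e n}"

definition dir_deriv :: "'k::real_vector \<Rightarrow> ('k \<Rightarrow> real) \<Rightarrow> 'k \<Rightarrow> real" where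
  "dir_deriv v F u = deriv (\<lambda>t. F (u + t *\<^sub>R v)) 0"

definition de :: "('h::complex_inner \<Rightarrow> 'k::complex_inner) \<Rightarrow> (nat \<Rightarrow> 'h) \<Rightarrow> nat \<Rightarrow> ('k \<Rightarrow> real) \<Rightarrow> 'k \<Rightarrow> real"
  where "de \<iota> e j = dir_deriv (\<iota> (e j))"

definition df :: "('h::complex_inner \<Rightarrow> 'k::complex_inner) \<Rightarrow> (nat \<Rightarrow> 'h) \<Rightarrow> nat \<Rightarrow> ('k \<Rightarrow> real) \<Rightarrow> 'k \<Rightarrow> real"
  where "df \<iota> e j = dir_deriv (\<iota> (\<i> *\<^sub>C e j))"

text \<open>The series below are used for cylindrical \<open>F\<close> and \<open>G\<close> only, where all but finitely many terms
  vanish.\<close>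

definition cyl_grad ::
  "('h::complex_inner \<Rightarrow> 'k::complex_inner) \<Rightarrow> (nat \<Rightarrow> 'h) \<Rightarrow> ('k \<Rightarrow> real) \<Rightarrow> 'k \<Rightarrow> 'k" where
  "cyl_grad \<iota> e F u = (\<Sum>j. de \<iota> e j F u *\<^sub>R \<iota> (e j) + df \<iota> e j F u *\<^sub>R \<iota> (\<i> *\<^sub>C e j))"

definition poisson ::
  "('h::complex_inner \<Rightarrow> 'k::complex_inner) \<Rightarrow> (nat \<Rightarrow> 'h) \<Rightarrow> ('k \<Rightarrow> real) \<Rightarrow> ('k \<Rightarrow> real) \<Rightarrow> 'k \<Rightarrow> real"
  where
  "poisson \<iota> e F G u = (\<Sum>j. de \<iota> e j F u * df \<iota> e j G u - de \<iota> e j G u * df \<iota> e j F u)"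


section \<open>The Malliavin derivative\<close>

definition in_Lp ::
  "real \<Rightarrow> 'a measure \<Rightarrow> ('a \<Rightarrow> 'b::{real_normed_vector, second_countable_topology}) \<Rightarrow> bool" where
  "in_Lp p M f \<longleftrightarrow> f \<in> borel_measurable M \<and> integrable M (\<lambda>x. norm (f x) powr p)"

definition Lp_tendsto ::
  "real \<Rightarrow> 'a measure \<Rightarrow> (nat \<Rightarrow> 'a \<Rightarrow> 'b::{real_normed_vector, second_countable_topology}) \<Rightarrow>
   ('a \<Rightarrow> 'b) \<Rightarrow> bool" where
  "Lp_tendsto p M fs f \<longleftrightarrow>
     (\<forall>n. in_Lp p M (fs n)) \<and> in_Lp p M f \<and>
     (\<lambda>n. \<integral>x. norm (fs n x - f x) powr p \<partial>M) \<longlonglongrightarrow> 0"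

text \<open>\<open>DF\<close> is a version of the gradient of \<open>F\<close>; by closability it is unique almost everywhere.\<close>

definition malliavin_deriv ::
  "('h::complex_inner \<Rightarrow> 'k::separable_chilbert) \<Rightarrow> (nat \<Rightarrow> 'h) \<Rightarrow> real \<Rightarrow> 'k measure \<Rightarrow>
   ('k \<Rightarrow> real) \<Rightarrow> ('k \<Rightarrow> 'k) \<Rightarrow> bool" where
  "malliavin_deriv \<iota> e p \<mu> F DF \<longleftrightarrow>
     (\<exists>Fs. (\<forall>n. Fs n \<in> Cc_cyl \<iota> e) \<and> Lp_tendsto p \<mu> Fs F \<and>
           Lp_tendsto p \<mu> (\<lambda>n. cyl_grad \<iota> e (Fs n)) DF)"

definition malliavin_sobolev ::
  "('h::complex_inner \<Rightarrow> 'k::separable_chilbert) \<Rightarrow> (nat \<Rightarrow> 'h) \<Rightarrow> real \<Rightarrow> 'k measure \<Rightarrow>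
   ('k \<Rightarrow> real) set" where
  "malliavin_sobolev \<iota> e p \<mu> = {F. \<exists>DF. malliavin_deriv \<iota> e p \<mu> F DF}"


section \<open>Gibbs measures and KMS states\<close>

definition gibbs_measure :: "real \<Rightarrow> ('k \<Rightarrow> real) \<Rightarrow> 'k measure \<Rightarrow> 'k measure" where
  "gibbs_measure \<beta> h \<mu> =
     density \<mu> (\<lambda>u. ennreal (exp (- \<beta> * h u) / (\<integral>v. exp (- \<beta> * h v) \<partial>\<mu>)))"

text \<open>The functions \<open>Re \<langle>\<nabla>F, -\<i>Au\<rangle>\<close> and \<open>Re \<langle>\<nabla>F, -\<i>\<nabla>h\<rangle>\<close>, where \<open>Dh\<close> stands for \<open>\<nabla>h\<close>.\<close>

definition free_term ::
  "('h::complex_inner \<Rightarrow> 'k::complex_inner) \<Rightarrow> (nat \<Rightarrow> 'h) \<Rightarrow> (nat \<Rightarrow> real) \<Rightarrow> ('k \<Rightarrow> real) \<Rightarrow> 'k \<Rightarrow> real"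
  where
  "free_term \<iota> e lam F u =
     (\<Sum>j. lam j * (de \<iota> e j F u * pairing \<iota> u (\<i> *\<^sub>C e j) - df \<iota> e j F u * pairing \<iota> u (e j)))"

definition interaction_term ::
  "('h::complex_inner \<Rightarrow> 'k::complex_inner) \<Rightarrow> (nat \<Rightarrow> 'h) \<Rightarrow> ('k \<Rightarrow> 'k) \<Rightarrow> ('k \<Rightarrow> real) \<Rightarrow> 'k \<Rightarrow> real"
  where
  "interaction_term \<iota> e Dh F u =
     (\<Sum>j. de \<iota> e j F u * pairing \<iota> (Dh u) (\<i> *\<^sub>C e j) - df \<iota> e j F u * pairing \<iota> (Dh u) (e j))"

text \<open>The \<open>(\<beta>, X)\<close>-KMS condition for \<open>X u = -\<i>Au - \<i> Dh u\<close>. Integrability of both integrands is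
  demanded explicitly, since the Bochner integral of a non-integrable function is \<open>0\<close>.\<close>

definition KMS_state ::
  "('h::complex_inner \<Rightarrow> 'k::separable_chilbert) \<Rightarrow> (nat \<Rightarrow> 'h) \<Rightarrow> (nat \<Rightarrow> real) \<Rightarrow> real \<Rightarrow> ('k \<Rightarrow> 'k) \<Rightarrow>
   'k measure \<Rightarrow> bool" where
  "KMS_state \<iota> e lam \<beta> Dh \<mu> \<longleftrightarrow>
     prob_space \<mu> \<and> sets \<mu> = sets borel \<and>
     (\<forall>F\<in>Cc_cyl \<iota> e. \<forall>G\<in>Cc_cyl \<iota> e.
        integrable \<mu> (poisson \<iota> e F G) \<and>
        integrable \<mu> (\<lambda>u. (free_term \<iota> e lam F u + interaction_term \<iota> e Dh F u) * G u) \<and>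
        (\<integral>u. poisson \<iota> e F G u \<partial>\<mu>) =
        \<beta> * (\<integral>u. (free_term \<iota> e lam F u + interaction_term \<iota> e Dh F u) * G u \<partial>\<mu>))"

end

theory Submission
  imports Defs
begin

text \<open>In the coordinates \<open>\<langle>u, e\<^sub>j\<rangle>\<close>, \<open>\<langle>u, f\<^sub>j\<rangle>\<close> the characteristic function of the Gaussian measure factorizes, so the
  coordinates are independent centered normal variables of variance \<open>1 / (\<beta> \<lambda>\<^sub>j)\<close>, and Gaussian integration
  by parts holds along every basis vector for bounded \<open>C\<^sup>1\<close> functions of finitely many coordinates.
  Approximating \<open>h\<close> by cylindrical functions and \<open>exp (- \<beta> h)\<close> by bounded functions of \<open>h\<close> gives
  \<open>\<integral> \<partial>\<^sub>v K e\<^sup>-\<^sup>\<beta>\<^sup>h d\<mu> = \<beta> \<integral> K (\<lambda>\<^sub>j \<langle>u, v\<rangle> + \<langle>\<nabla>h, v\<rangle>) e\<^sup>-\<^sup>\<beta>\<^sup>h d\<mu>\<close> for \<open>v = e\<^sub>j\<close> and \<open>v = f\<^sub>j\<close>. The KMS identity is the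
  difference of the instances \<open>K = (\<partial>\<^sub>e F) G\<close>, \<open>v = f\<^sub>j\<close> and \<open>K = (\<partial>\<^sub>f F) G\<close>, \<open>v = e\<^sub>j\<close>, summed over \<open>j\<close>; the second
  derivatives of \<open>F\<close> cancel by symmetry.\<close>

section \<open>Independence and Gaussian integration by parts\<close>

text \<open>\<open>h\<close> is only an L2 limit of cylindrical functions, and
  \<open>exp (- \<beta> * h u)\<close> is merely integrable, so the two cannot be approximated at
  the same time. The order of the limits is fixed: the cylindrical functions converge while the
  exponential is replaced by a bounded function of \<open>h\<close> with bounded Lipschitz
  derivative, and only then does this function increase to the exponential. In the second limit
  square integrability of the gradient gives no majorant; the majorant is the assumed integrability
  of the gradient, paired with a basis vector and multiplied by the weight. The other unbounded
  factor is the Gaussian coordinate of \<open>u\<close>. It needs no moment bound under the weighted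
  measure, because the Poisson bracket couples directions of the same index: if the derivative of
  \<open>F\<close> in one of them is not identically zero, the coordinate along the other is among
  the variables of a compactly supported function.\<close>

lemma std_normal_integration_by_parts:
  fixes f f' :: "real \<Rightarrow> real"
  assumes der: "\<And>x. (f has_real_derivative f' x) (at x)"
    and cont: "continuous_on UNIV f'"
    and f: "\<And>x. \<bar>f x\<bar> \<le> B" and f': "\<And>x. \<bar>f' x\<bar> \<le> B'"
  shows "(\<integral>x. f' x \<partial>std_normal_distribution) = (\<integral>x. x * f x \<partial>std_normal_distribution)"
proof -
  let ?d = std_normal_density
  let ?g = "\<lambda>x. f' x * ?d x - x * f x * ?d x"
  have contf: "continuous_on UNIV f"
    using der by (meson DERIV_continuous continuous_at_imp_continuous_on)
  have [measurable]: "f \<in> borel_measurable borel" "f' \<in> borel_measurable borel"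
    using contf cont by (auto intro: borel_measurable_continuous_onI)
  have dd: "(?d has_real_derivative - x * ?d x) (at x)" for x
    unfolding std_normal_density_def
    by (auto intro!: derivative_eq_intros simp: field_simps)
  have contd: "continuous_on UNIV ?d"
    using dd by (meson DERIV_continuous continuous_at_imp_continuous_on)
  have int1: "integrable lborel (\<lambda>x. f' x * ?d x)"
  proof (rule Bochner_Integration.integrable_bound)
    show "integrable lborel (\<lambda>x. B' * ?d x)" by simp
    show "AE x in lborel. norm (f' x * ?d x) \<le> norm (B' * ?d x)"
      using order_trans[OF f' abs_ge_self] by (auto simp: abs_mult intro!: mult_right_mono)
  qed simp
  have int2: "integrable lborel (\<lambda>x. x * f x * ?d x)"
  proof (rule Bochner_Integration.integrable_bound)
    show "integrable lborel (\<lambda>x. B * (?d x * \<bar>x\<bar> ^ 1))"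
      using integrable_std_normal_moment_abs[of 1] by simp
    show "AE x in lborel. norm (x * f x * ?d x) \<le> norm (B * (?d x * \<bar>x\<bar> ^ 1))"
    proof (rule AE_I2)
      fix x
      have "\<bar>f x\<bar> * (?d x * \<bar>x\<bar>) \<le> \<bar>B\<bar> * (?d x * \<bar>x\<bar>)"
        using order_trans[OF f abs_ge_self] by (intro mult_right_mono) auto
      then show "norm (x * f x * ?d x) \<le> norm (B * (?d x * \<bar>x\<bar> ^ 1))"
        by (simp add: abs_mult mult_ac)
    qed
  qed simp
  have lim: "((\<lambda>x. f x * ?d x) \<longlongrightarrow> 0) F" if "((?d) \<longlongrightarrow> 0) F" for F :: "real filter"
  proof (rule Lim_null_comparison)
    show "\<forall>\<^sub>F x in F. norm (f x * ?d x) \<le> B * ?d x"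
      using f by (auto simp: abs_mult intro!: always_eventually mult_right_mono)
    show "((\<lambda>x. B * ?d x) \<longlongrightarrow> 0) F"
      using tendsto_mult[OF tendsto_const that] by simp
  qed
  \<comment> \<open>\<open>?g\<close> is the derivative of \<open>f\<close> times the density, since
    the derivative of the density is \<open>- x\<close> times the density; the boundary terms vanish
    because \<open>f\<close> is bounded.\<close>
  have "(LBINT x=-\<infinity>..\<infinity>. ?g x) = 0 - 0"
  proof (rule interval_integral_FTC_integrable[where F = "\<lambda>x. f x * ?d x"])
    show "((\<lambda>x. f x * ?d x) has_vector_derivative ?g x) (at x)" for x
      unfolding has_real_derivative_iff_has_vector_derivative[symmetric]
      by (auto intro!: derivative_eq_intros der dd simp: algebra_simps)
    show "isCont ?g x" for x
      using cont contf contd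
      by (intro continuous_intros) (auto simp: continuous_on_eq_continuous_at)
    show "set_integrable lborel (einterval (-\<infinity>) \<infinity>) ?g"
      using int1 int2 by (simp add: set_integrable_def)
    have "(?d \<longlongrightarrow> 0) at_top" "(?d \<longlongrightarrow> 0) at_bot"
      unfolding std_normal_density_def by real_asymp+
    then show "(((\<lambda>x. f x * ?d x) \<circ> real_of_ereal) \<longlongrightarrow> 0) (at_right (- \<infinity>))"
      "(((\<lambda>x. f x * ?d x) \<circ> real_of_ereal) \<longlongrightarrow> 0) (at_left \<infinity>)"
      unfolding ereal_tendsto_simps1 by (auto intro!: lim)
  qed simp
  then have "(\<integral>x. ?g x \<partial>lborel) = 0"
    by (simp add: interval_lebesgue_integral_def set_lebesgue_integral_def)
  then have "(\<integral>x. f' x * ?d x \<partial>lborel) = (\<integral>x. x * f x * ?d x \<partial>lborel)"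
    using int1 int2 by simp
  then show ?thesis
    by (simp add: integral_density mult_ac)
qed

text \<open>The positive density \<open>2 + g\<close>, normalized, does not change the law of \<open>X\<close>, by Levy's uniqueness theorem.\<close>

lemma (in prob_space) independent_of_bounded_real_if_char:
  fixes X :: "'a \<Rightarrow> real" and g :: "'a \<Rightarrow> real"
  assumes [measurable]: "random_variable borel X" "random_variable borel g"
    and g: "\<And>x. \<bar>g x\<bar> \<le> 1"
    and char: "\<And>s. (\<integral>x. iexp (s * X x) * complex_of_real (g x) \<partial>M)
      = char (distr M borel X) s * complex_of_real (expectation g)"
    and [measurable]: "B \<in> sets borel"
  shows "(\<integral>x. indicator B (X x) * g x \<partial>M) = prob (X -` B \<inter> space M) * expectation g"
proof -
  have int_g: "integrable M g"
    by (rule integrable_const_bound[of _ 1]) (use g in auto)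
  \<comment> \<open>The shift 2 exceeds the bound 1 on \<open>g\<close>, so the normalizing constant
    stays positive even if \<open>g\<close> is -1 almost everywhere.\<close>
  define c where "c = 2 + expectation g"
  have "expectation g \<ge> expectation (\<lambda>x. -1)"
    by (rule integral_mono) (use g int_g in \<open>auto simp: abs_le_iff minus_le_iff\<close>)
  then have "c > 0" by (simp add: c_def prob_space)
  define q where "q x = (2 + g x) / c" for x
  have [measurable]: "q \<in> borel_measurable M" unfolding q_def by measurable
  have q0: "q x \<ge> 0" for x using g[of x] \<open>c > 0\<close> unfolding q_def by (auto simp: abs_le_iff)
  have int_q: "integrable M q" unfolding q_def using int_g by simp
  have "expectation q = 1"
    using \<open>c > 0\<close> int_g unfolding q_def by (simp add: prob_space c_def[symmetric])
  define N where "N = density M (\<lambda>x. ennreal (q x))"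
  have sN [measurable_cong]: "sets N = sets M" and [simp]: "space N = space M"
    by (simp_all add: N_def)
  have "emeasure N (space N) = 1"
    using q0 \<open>expectation q = 1\<close> int_q
    by (simp add: N_def emeasure_density nn_integral_eq_integral cong: nn_integral_cong)
  then interpret N: prob_space N by (rule prob_spaceI)
  have X_N [measurable]: "X \<in> borel_measurable N" by measurable
  have "char (distr N borel X) = char (distr M borel X)"
  proof
    fix s
    have int1: "integrable M (\<lambda>x. iexp (s * X x))"
      by (rule integrable_const_bound[of _ 1]) auto
    have int2: "integrable M (\<lambda>x. iexp (s * X x) * complex_of_real (g x))"
      by (rule integrable_const_bound[of _ 1]) (use g in \<open>auto simp: norm_mult\<close>)
    have "char (distr N borel X) s = (\<integral>x. q x *\<^sub>R iexp (s * X x) \<partial>M)"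
      unfolding char_def N_def using q0
      by (subst integral_distr) (auto intro!: integral_density)
    also have "\<dots> = (\<integral>x. (2 * iexp (s * X x) + iexp (s * X x) * complex_of_real (g x)) / c \<partial>M)"
      by (intro Bochner_Integration.integral_cong) (auto simp: q_def scaleR_conv_of_real field_simps)
    also have "\<dots> = (2 * (\<integral>x. iexp (s * X x) \<partial>M) + (\<integral>x. iexp (s * X x) * complex_of_real (g x) \<partial>M)) / c"
      unfolding integral_divide_zero
      by (subst Bochner_Integration.integral_add[OF integrable_mult_right[OF int1] int2]) simp
    also have "(\<integral>x. iexp (s * X x) \<partial>M) = char (distr M borel X) s"
      unfolding char_def by (subst integral_distr) auto
    finally have "char (distr N borel X) s = char (distr M borel X) s * complex_of_real c / complex_of_real c"
      unfolding char by (simp add: c_def algebra_simps)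
    then show "char (distr N borel X) s = char (distr M borel X) s"
      using \<open>c > 0\<close> by simp
  qed
  then have eq: "distr N borel X = distr M borel X"
    by (intro Levy_uniqueness) auto
  have "(\<integral>x. q x *\<^sub>R (indicator B (X x) :: real) \<partial>M) = (\<integral>x. indicator B (X x) \<partial>N)"
    unfolding N_def using q0 by (subst integral_density) auto
  also have "\<dots> = (\<integral>y. indicator B y \<partial>distr N borel X)"
    by (subst integral_distr) auto
  also have "\<dots> = prob (X -` B \<inter> space M)"
    unfolding eq by (simp add: measure_distr)
  finally have *: "(\<integral>x. q x *\<^sub>R (indicator B (X x) :: real) \<partial>M) = prob (X -` B \<inter> space M)" .
  have [simp]: "integrable M (\<lambda>x. indicator B (X x) * g x)" "integrable M (\<lambda>x. indicator B (X x) :: real)"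
    by (rule integrable_const_bound[of _ 1]; use g in \<open>auto simp: indicator_def\<close>)+
  have "(\<integral>x. (indicator B (X x) :: real) \<partial>M) = (\<integral>y. indicator B y \<partial>distr M borel X)"
    by (subst integral_distr) auto
  also have "\<dots> = prob (X -` B \<inter> space M)"
    by (simp add: measure_distr)
  finally have **: "(\<integral>x. (indicator B (X x) :: real) \<partial>M) = prob (X -` B \<inter> space M)" .
  \<comment> \<open>Comparison of this second evaluation with \<open>*\<close> leaves the factor
    \<open>c - 2\<close>, which is the expectation of \<open>g\<close>.\<close>
  have "(\<integral>x. q x *\<^sub>R (indicator B (X x) :: real) \<partial>M)
      = (\<integral>x. (2 * indicator B (X x) + indicator B (X x) * g x) / c \<partial>M)"
    by (intro Bochner_Integration.integral_cong) (auto simp: q_def field_simps)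
  also have "\<dots> = (2 * prob (X -` B \<inter> space M) + (\<integral>x. indicator B (X x) * g x \<partial>M)) / c"
    by (simp add: **)
  finally show ?thesis using * \<open>c > 0\<close> by (simp add: c_def field_simps)
qed

text \<open>Conjugating the hypothesis at \<open>- s\<close> gives the same hypothesis for
  \<open>cnj (w x)\<close>, because \<open>X\<close> is real. The real and imaginary parts are
  linear combinations of \<open>w\<close> and its conjugate, so the real case applies to
  each.\<close>

lemma (in prob_space) independent_of_bounded_complex_if_char:
  fixes X :: "'a \<Rightarrow> real" and w :: "'a \<Rightarrow> complex"
  assumes [measurable]: "random_variable borel X" "random_variable borel w"
    and w: "\<And>x. cmod (w x) \<le> 1"
    and char: "\<And>s. (\<integral>x. iexp (s * X x) * w x \<partial>M) = char (distr M borel X) s * expectation w"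
    and [measurable]: "B \<in> sets borel"
  shows "(\<integral>x. indicator B (X x) * w x \<partial>M) = prob (X -` B \<inter> space M) * expectation w"
proof -
  have int_w: "integrable M w"
    by (rule integrable_const_bound[of _ 1]) (use w in auto)
  then have [measurable]: "random_variable borel (\<lambda>x. cnj (w x))"
    by (intro borel_measurable_integrable integrable_cnj)
  have int: "integrable M (\<lambda>x. iexp (s * X x) * w x)" "integrable M (\<lambda>x. iexp (s * X x) * cnj (w x))" for s
    by (rule integrable_const_bound[of _ 1]; use w in \<open>auto simp: norm_mult\<close>)+
  have char_minus: "cnj (char (distr M borel X) (- s)) = char (distr M borel X) s" for s
    unfolding char_def using Bochner_Integration.integral_cnj[of "distr M borel X" "\<lambda>x. iexp (- s * x)"] by (simp add: exp_cnj)
  have char_cnj: "(\<integral>x. iexp (s * X x) * cnj (w x) \<partial>M)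
      = char (distr M borel X) s * cnj (expectation w)" for s
  proof -
    have "(\<integral>x. iexp (s * X x) * cnj (w x) \<partial>M) = cnj (\<integral>x. iexp (- s * X x) * w x \<partial>M)"
      by (simp add: exp_cnj flip: Bochner_Integration.integral_cnj)
    then show ?thesis using char[of "- s"] by (simp add: char_minus)
  qed
  have Re: "(\<integral>x. indicator B (X x) * Re (w x) \<partial>M) = prob (X -` B \<inter> space M) * (\<integral>x. Re (w x) \<partial>M)"
  proof (rule independent_of_bounded_real_if_char)
    fix s
    have "(\<integral>x. iexp (s * X x) * complex_of_real (Re (w x)) \<partial>M)
        = (\<integral>x. (iexp (s * X x) * w x + iexp (s * X x) * cnj (w x)) / 2 \<partial>M)"
      by (intro Bochner_Integration.integral_cong) (auto simp: complex_eq_iff algebra_simps)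
    also have "\<dots> = char (distr M borel X) s * ((expectation w + cnj (expectation w)) / 2)"
      unfolding integral_divide_zero
      by (subst Bochner_Integration.integral_add[OF int]) (simp only: char char_cnj distrib_left times_divide_eq_right)
    also have "(expectation w + cnj (expectation w)) / 2 = complex_of_real (\<integral>x. Re (w x) \<partial>M)"
      using int_w by (simp add: complex_eq_iff)
    finally show "(\<integral>x. iexp (s * X x) * complex_of_real (Re (w x)) \<partial>M)
        = char (distr M borel X) s * complex_of_real (\<integral>x. Re (w x) \<partial>M)" .
  qed (use order_trans[OF abs_Re_le_cmod w] in auto)
  have Im: "(\<integral>x. indicator B (X x) * Im (w x) \<partial>M) = prob (X -` B \<inter> space M) * (\<integral>x. Im (w x) \<partial>M)"
  proof (rule independent_of_bounded_real_if_char)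
    fix s
    have "(\<integral>x. iexp (s * X x) * complex_of_real (Im (w x)) \<partial>M)
        = (\<integral>x. (iexp (s * X x) * w x - iexp (s * X x) * cnj (w x)) / (2 * \<i>) \<partial>M)"
      by (intro Bochner_Integration.integral_cong) (simp_all add: complex_diff_cnj complex_eq_iff flip: right_diff_distrib)
    also have "\<dots> = char (distr M borel X) s * ((expectation w - cnj (expectation w)) / (2 * \<i>))"
      unfolding integral_divide_zero
      by (subst Bochner_Integration.integral_diff[OF int]) (simp only: char char_cnj right_diff_distrib times_divide_eq_right)
    also have "(expectation w - cnj (expectation w)) / (2 * \<i>) = complex_of_real (\<integral>x. Im (w x) \<partial>M)"
      using int_w by (simp add: complex_eq_iff)
    finally show "(\<integral>x. iexp (s * X x) * complex_of_real (Im (w x)) \<partial>M)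
        = char (distr M borel X) s * complex_of_real (\<integral>x. Im (w x) \<partial>M)" .
  qed (use order_trans[OF abs_Im_le_cmod w] in auto)
  have "integrable M (\<lambda>x. indicator B (X x) * w x)"
    by (rule integrable_const_bound[of _ 1]) (use w in \<open>auto simp: indicator_def\<close>)
  moreover have "Re (indicator B (X x) * w x) = indicator B (X x) * Re (w x)"
    "Im (indicator B (X x) * w x) = indicator B (X x) * Im (w x)" for x
    by (auto simp: indicator_def)
  ultimately show ?thesis
    using int_w Re Im by (simp add: complex_eq_iff flip: integral_Re integral_Im)
qed

text \<open>Exponentials are exchanged for indicators one index at a time. At each exchange the
  product of all remaining factors is a bounded complex variable, so uniqueness of one-dimensional
  laws is enough.\<close>

lemma (in prob_space) indep_vars_if_char:
  fixes X :: "'i \<Rightarrow> 'a \<Rightarrow> real"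
  assumes "finite I" and rv: "\<And>i. i \<in> I \<Longrightarrow> random_variable borel (X i)"
    and char: "\<And>a. (\<integral>x. iexp (\<Sum>i\<in>I. a i * X i x) \<partial>M) = (\<Prod>i\<in>I. char (distr M borel (X i)) (a i))"
  shows "indep_vars (\<lambda>_. borel) X I"
proof (cases "I = {}")
  \<comment> \<open>Split off because over the empty index set the intersection in the product
    criterion is \<open>UNIV\<close> instead of the sample space.\<close>
  case True
  then show ?thesis by (simp add: indep_vars_def indep_sets_def)
next
  case False
  \<comment> \<open>\<open>J\<close> collects the indices that already carry indicators. For empty
    \<open>J\<close> this is the hypothesis \<open>char\<close>, for \<open>J = I\<close> the
    product formula for probabilities.\<close>
  have key: "(\<integral>x. (\<Prod>j\<in>J. indicator (B j) (X j x)) * iexp (\<Sum>i\<in>I - J. a i * X i x) \<partial>M)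
      = (\<Prod>j\<in>J. complex_of_real (prob (X j -` B j \<inter> space M))) * (\<Prod>i\<in>I - J. char (distr M borel (X i)) (a i))"
    if "finite J" "J \<subseteq> I" "\<And>j. j \<in> J \<Longrightarrow> B j \<in> sets borel" for J a B
    using that
  proof (induction J arbitrary: a rule: finite_induct)
    case empty
    then show ?case using char by simp
  next
    case (insert k J)
    have [measurable]: "random_variable borel (X k)" "B k \<in> sets borel"
      using insert rv by auto
    have I: "I - J = insert k (I - insert k J)" "finite (I - insert k J)"
      using insert \<open>finite I\<close> by auto
    have [measurable]: "i \<in> I \<Longrightarrow> random_variable borel (X i)" for i by (rule rv)
    define w :: "'a \<Rightarrow> complex" where
      "w x = (\<Prod>j\<in>J. indicator (B j) (X j x)) * iexp (\<Sum>i\<in>I - insert k J. a i * X i x)" for x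
    have "random_variable borel (\<lambda>x. indicator (B j) (X j x) :: complex)" if "j \<in> J" for j
    proof -
      have [measurable]: "B j \<in> sets borel" "random_variable borel (X j)" using insert that rv by auto
      show ?thesis by measurable
    qed
    moreover have "random_variable borel (\<lambda>x. \<Sum>i\<in>I - insert k J. a i * X i x)"
      using rv by (intro borel_measurable_sum borel_measurable_times) auto
    ultimately have w_meas [measurable]: "random_variable borel w"
      unfolding w_def by (intro borel_measurable_times borel_measurable_prod) auto
    have w_le: "cmod (w x) \<le> 1" for x
      by (auto simp: w_def norm_mult prod_norm[symmetric] indicator_def intro!: prod_le_1)
    \<comment> \<open>The induction hypothesis holds for all coefficients, so the one at
      \<open>k\<close> may be set to an arbitrary \<open>t\<close>; the choice \<open>t = 0\<close>
      then yields the expectation of \<open>w\<close>.\<close>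
    have eq: "(\<integral>x. iexp (t * X k x) * w x \<partial>M) = char (distr M borel (X k)) t
       * ((\<Prod>j\<in>J. complex_of_real (prob (X j -` B j \<inter> space M))) * (\<Prod>i\<in>I - insert k J. char (distr M borel (X i)) (a i)))" for t
    proof -
      have "(\<integral>x. iexp (t * X k x) * w x \<partial>M)
        = (\<integral>x. (\<Prod>j\<in>J. indicator (B j) (X j x)) * iexp (\<Sum>i\<in>I - J. (a(k := t)) i * X i x) \<partial>M)"
        unfolding w_def I(1) using I(2)
        by (auto simp: distrib_left exp_add mult_ac intro!: Bochner_Integration.integral_cong sum.cong arg_cong[where f=exp])
      also have "\<dots> = (\<Prod>j\<in>J. complex_of_real (prob (X j -` B j \<inter> space M))) * (\<Prod>i\<in>I - J. char (distr M borel (X i)) ((a(k := t)) i))"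
        using insert by (intro insert.IH) auto
      also have "(\<Prod>i\<in>I - J. char (distr M borel (X i)) ((a(k := t)) i))
        = char (distr M borel (X k)) t * (\<Prod>i\<in>I - insert k J. char (distr M borel (X i)) (a i))"
        unfolding I(1) using I(2) by (auto intro!: prod.cong)
      finally show ?thesis by simp
    qed
    have "char (distr M borel (X k)) 0 = 1"
      by (simp add: real_distribution.char_zero)
    then have Ew: "expectation w = (\<Prod>j\<in>J. complex_of_real (prob (X j -` B j \<inter> space M))) * (\<Prod>i\<in>I - insert k J. char (distr M borel (X i)) (a i))"
      using eq[of 0] by simp
    have "(\<integral>x. indicator (B k) (X k x) * w x \<partial>M) = prob (X k -` B k \<inter> space M) * expectation w"
      using eq unfolding Ew[symmetric] by (intro independent_of_bounded_complex_if_char w_le) auto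
    then show ?case
      using insert by (simp add: Ew w_def mult_ac)
  qed
  show ?thesis
  proof (subst indep_vars_finite[where E = "\<lambda>_. sets borel"])
    show "\<forall>A\<in>(\<Pi> i\<in>I. sets borel). prob (\<Inter>j\<in>I. X j -` A j \<inter> space M) = (\<Prod>j\<in>I. prob (X j -` A j \<inter> space M))"
    proof
      fix A assume A: "A \<in> (\<Pi> i\<in>I. sets (borel :: real measure))"
      have [measurable]: "(\<Inter>j\<in>I. X j -` A j \<inter> space M) \<in> events"
        using A rv False \<open>finite I\<close> by (intro sets.finite_INT measurable_sets) auto
      have "complex_of_real (prob (\<Inter>j\<in>I. X j -` A j \<inter> space M))
        = (\<integral>x. complex_of_real (indicator (\<Inter>j\<in>I. X j -` A j \<inter> space M) x) \<partial>M)"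
        using False by (subst integral_complex_of_real) simp
      also have "\<dots> = (\<integral>x. (\<Prod>j\<in>I. indicator (A j) (X j x)) * iexp (\<Sum>i\<in>I - I. 0 * X i x) \<partial>M)"
        using False \<open>finite I\<close>
        by (intro Bochner_Integration.integral_cong) (auto simp: indicator_def)
      also have "\<dots> = complex_of_real (\<Prod>j\<in>I. prob (X j -` A j \<inter> space M))"
        using A \<open>finite I\<close> by (subst key[of I A "\<lambda>_. 0"]) auto
      finally show "prob (\<Inter>j\<in>I. X j -` A j \<inter> space M) = (\<Prod>j\<in>I. prob (X j -` A j \<inter> space M))"
        using of_real_eq_iff by blast
    qed
  qed (use False \<open>finite I\<close> rv sets.sigma_sets_eq[of "borel :: real measure"] in \<open>auto simp: Int_stable_def\<close>)
qed

text \<open>By Fubini for the joint law of \<open>W\<close> and \<open>Y\<close>, the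
  one-dimensional identity is applied for each frozen value of \<open>Y\<close>. The normal variable
  is written as \<open>f (W x)\<close> since \<open>W\<close> will be a family indexed by a
  singleton and \<open>f\<close> the evaluation at its index.\<close>

lemma (in prob_space) std_normal_independent_integration_by_parts:
  fixes W Y :: "'a \<Rightarrow> 'b" and f :: "'b \<Rightarrow> real" and \<Phi> \<Phi>' :: "real \<Rightarrow> 'b \<Rightarrow> real"
  assumes indep: "indep_var S W N Y"
    and [measurable]: "f \<in> borel_measurable S"
    and distr_W: "distr M borel (\<lambda>x. f (W x)) = std_normal_distribution"
    and [measurable]: "case_prod \<Phi> \<in> borel_measurable (borel \<Otimes>\<^sub>M N)"
      "case_prod \<Phi>' \<in> borel_measurable (borel \<Otimes>\<^sub>M N)"
    and der: "\<And>z y. y \<in> space N \<Longrightarrow> ((\<lambda>z. \<Phi> z y) has_real_derivative \<Phi>' z y) (at z)"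
    and cont: "\<And>y. y \<in> space N \<Longrightarrow> continuous_on UNIV (\<lambda>z. \<Phi>' z y)"
    and bound: "\<And>z y. \<bar>\<Phi> z y\<bar> \<le> B" "\<And>z y. \<bar>\<Phi>' z y\<bar> \<le> B'"
  shows "expectation (\<lambda>x. \<Phi>' (f (W x)) (Y x)) = expectation (\<lambda>x. f (W x) * \<Phi> (f (W x)) (Y x))"
proof -
  have [measurable]: "random_variable S W" "random_variable N Y"
    using indep_var_rv1[OF indep] indep_var_rv2[OF indep] .
  let ?S = "distr M S W" and ?T = "distr M N Y"
  interpret S: prob_space ?S by (rule prob_space_distr) simp
  interpret T: prob_space ?T by (rule prob_space_distr) simp
  interpret ST: pair_prob_space ?S ?T ..
  have eq: "distr M (S \<Otimes>\<^sub>M N) (\<lambda>x. (W x, Y x)) = ?S \<Otimes>\<^sub>M ?T"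
    using indep unfolding indep_var_distribution_eq by simp
  have distr_S: "distr ?S borel f = std_normal_distribution"
    unfolding distr_W[symmetric] by (subst distr_distr) (auto simp: comp_def)
  have int': "integrable (?S \<Otimes>\<^sub>M ?T) (\<lambda>(w, y). \<Phi>' (f w) y)"
    by (rule ST.P.integrable_const_bound[of _ B']) (use bound in auto)
  have "integrable std_normal_distribution (\<lambda>z. \<bar>z\<bar>)"
    using integrable_std_normal_moment_abs[of 1] by (subst integrable_density) auto
  then have "integrable M (\<lambda>x. f (W x))"
    unfolding distr_W[symmetric] by (subst (asm) integrable_distr_eq) (auto simp: integrable_abs_iff)
  then have "integrable M (\<lambda>x. B * f (W x))" by simp
  then have "integrable M (\<lambda>x. f (W x) * \<Phi> (f (W x)) (Y x))"
  proof (rule Bochner_Integration.integrable_bound)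
    show "AE x in M. norm (f (W x) * \<Phi> (f (W x)) (Y x)) \<le> norm (B * f (W x))"
      using order_trans[OF bound(1) abs_ge_self] by (auto simp: abs_mult mult.commute[of "\<bar>B\<bar>"] intro!: AE_I2 mult_left_mono)
  qed simp
  then have int: "integrable (?S \<Otimes>\<^sub>M ?T) (\<lambda>(w, y). f w * \<Phi> (f w) y)"
    unfolding eq[symmetric] by (subst integrable_distr_eq) auto
  have "expectation (\<lambda>x. \<Phi>' (f (W x)) (Y x)) = (\<integral>(w, y). \<Phi>' (f w) y \<partial>(?S \<Otimes>\<^sub>M ?T))"
    unfolding eq[symmetric] by (subst integral_distr) auto
  also have "\<dots> = (\<integral>y. (\<integral>w. \<Phi>' (f w) y \<partial>?S) \<partial>?T)"
    using ST.integral_snd[OF int'] by simp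
  also have "\<dots> = (\<integral>y. (\<integral>w. f w * \<Phi> (f w) y \<partial>?S) \<partial>?T)"
  proof (rule Bochner_Integration.integral_cong[OF refl])
    fix y assume "y \<in> space ?T"
    then have y: "y \<in> space N" by simp
    then have [measurable]: "(\<lambda>z. \<Phi> z y) \<in> borel_measurable borel" "(\<lambda>z. \<Phi>' z y) \<in> borel_measurable borel"
      by measurable
    have "(\<integral>w. \<Phi>' (f w) y \<partial>?S) = (\<integral>z. \<Phi>' z y \<partial>std_normal_distribution)"
      unfolding distr_S[symmetric] by (subst integral_distr[of f ?S]) auto
    also have "\<dots> = (\<integral>z. z * \<Phi> z y \<partial>std_normal_distribution)"
      by (rule std_normal_integration_by_parts[OF der[OF y] cont[OF y] bound])
    also have "\<dots> = (\<integral>w. f w * \<Phi> (f w) y \<partial>?S)"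
      unfolding distr_S[symmetric] by (subst integral_distr[of f ?S]) auto
    finally show "(\<integral>w. \<Phi>' (f w) y \<partial>?S) = (\<integral>w. f w * \<Phi> (f w) y \<partial>?S)" .
  qed
  also have "\<dots> = (\<integral>(w, y). f w * \<Phi> (f w) y \<partial>(?S \<Otimes>\<^sub>M ?T))"
    using ST.integral_snd[OF int] by simp
  also have "\<dots> = expectation (\<lambda>x. f (W x) * \<Phi> (f (W x)) (Y x))"
    unfolding eq[symmetric] by (subst integral_distr) auto
  finally show ?thesis .
qed

section \<open>Linear coordinates with independent normal laws\<close>

lemma bounded_range_mult:
  fixes f g :: "'a \<Rightarrow> real"
  assumes "bounded (range f)" "bounded (range g)"
  shows "bounded (range (\<lambda>u. f u * g u))"
proof -
  obtain B C where "\<And>u. \<bar>f u\<bar> \<le> B" "\<And>u. \<bar>g u\<bar> \<le> C"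
    using assms by (auto simp: bounded_iff)
  then have "\<bar>f u * g u\<bar> \<le> B * C" for u
    unfolding abs_mult by (intro mult_mono) (auto intro: order_trans[OF abs_ge_zero])
  then show ?thesis by (auto simp: bounded_iff)
qed

text \<open>\<open>\<kappa> i\<close> is the reciprocal of the variance of \<open>X i\<close>. The
  single condition \<open>char_X\<close> on linear combinations encodes both normality and
  independence, and \<open>b\<close> is the system of directions dual to \<open>X\<close>.\<close>

locale gaussian_coordinates = prob_space M
  for M :: "'k::{real_normed_vector, second_countable_topology} measure" +
  fixes X :: "'i \<Rightarrow> 'k \<Rightarrow> real" and b :: "'i \<Rightarrow> 'k" and \<kappa> :: "'i \<Rightarrow> real"
  assumes sets_M [measurable_cong]: "sets M = sets borel"
    and bounded_linear_X: "bounded_linear (X i)"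
    and X_b: "X i (b j) = (if i = j then 1 else 0)"
    and \<kappa>_pos: "\<kappa> i > 0"
    and char_X: "finite I \<Longrightarrow>
      (\<integral>u. iexp (\<Sum>i\<in>I. a i * X i u) \<partial>M) = complex_of_real (exp (- (\<Sum>i\<in>I. (a i)\<^sup>2 / \<kappa> i) / 2))"
begin

lemma space_M [simp]: "space M = UNIV"
  using sets_eq_imp_space_eq[OF sets_M] by simp

lemma continuous_X: "continuous_on S (X i)"
  using bounded_linear_X by (intro linear_continuous_on)

lemma measurable_X [measurable]: "X i \<in> borel_measurable borel"
  by (intro borel_measurable_continuous_onI continuous_X)

lemma X_add: "X i (u + v) = X i u + X i v"
  and X_scaleR: "X i (r *\<^sub>R u) = r * X i u"
  and X_sum: "X i (sum g S) = (\<Sum>j\<in>S. X i (g j))"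
  using bounded_linear.linear[OF bounded_linear_X, of i] by (auto simp: linear_add linear_scale linear_sum)

lemma X_line: "X j (u + t *\<^sub>R b i) = (if i = j then X i u + t else X j u)"
  by (simp add: X_add X_scaleR X_b)

lemma char_standardized:
  "char (distr M borel (\<lambda>u. sqrt (\<kappa> i) * X i u)) t = complex_of_real (exp (- t\<^sup>2 / 2))"
proof -
  have "char (distr M borel (\<lambda>u. sqrt (\<kappa> i) * X i u)) t = (\<integral>u. iexp (\<Sum>j\<in>{i}. (t * sqrt (\<kappa> j)) * X j u) \<partial>M)"
    unfolding char_def by (subst integral_distr) (auto simp: mult_ac)
  also have "\<dots> = complex_of_real (exp (- t\<^sup>2 / 2))"
    using \<kappa>_pos[of i] by (subst char_X) (auto simp: power_mult_distrib)
  finally show ?thesis .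
qed

lemma distr_standardized: "distr M borel (\<lambda>u. sqrt (\<kappa> i) * X i u) = std_normal_distribution"
proof (rule Levy_uniqueness)
  show "char (distr M borel (\<lambda>u. sqrt (\<kappa> i) * X i u)) = char std_normal_distribution"
    by (rule ext) (simp add: char_standardized char_std_normal_distribution)
qed (auto simp: real_dist_normal_dist)

lemma indep_vars_standardized:
  assumes "finite I" shows "indep_vars (\<lambda>_. borel) (\<lambda>i u. sqrt (\<kappa> i) * X i u) I"
proof (rule indep_vars_if_char[OF assms])
  fix a :: "'i \<Rightarrow> real"
  have "(\<integral>u. iexp (\<Sum>i\<in>I. a i * (sqrt (\<kappa> i) * X i u)) \<partial>M)
      = complex_of_real (exp (- (\<Sum>i\<in>I. (a i * sqrt (\<kappa> i))\<^sup>2 / \<kappa> i) / 2))"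
    using char_X[OF assms, of "\<lambda>i. a i * sqrt (\<kappa> i)"] by (simp add: mult_ac)
  also have "(\<Sum>i\<in>I. (a i * sqrt (\<kappa> i))\<^sup>2 / \<kappa> i) = (\<Sum>i\<in>I. (a i)\<^sup>2)"
    using \<kappa>_pos less_imp_neq[OF \<kappa>_pos] by (intro sum.cong) (auto simp: power_mult_distrib less_imp_le)
  also have "complex_of_real (exp (- (\<Sum>i\<in>I. (a i)\<^sup>2) / 2)) = (\<Prod>i\<in>I. complex_of_real (exp (- (a i)\<^sup>2 / 2)))"
    using assms by (simp add: sum_divide_distrib exp_sum flip: sum_negf of_real_prod)
  finally show "(\<integral>u. iexp (\<Sum>i\<in>I. a i * (sqrt (\<kappa> i) * X i u)) \<partial>M)
      = (\<Prod>i\<in>I. char (distr M borel (\<lambda>u. sqrt (\<kappa> i) * X i u)) (a i))"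
    by (simp add: char_standardized)
qed simp

text \<open>Compact support is replaced by boundedness, because the class must contain compositions
  \<open>\<psi> (\<Psi> u)\<close> where \<open>\<psi> 0\<close> is not zero. Only one direction
  \<open>b i\<close> is involved, so no representation through a function on a Euclidean space has
  to be carried along.\<close>

definition cylinder_C1 :: "'i \<Rightarrow> ('k \<Rightarrow> real) \<Rightarrow> ('k \<Rightarrow> real) \<Rightarrow> bool" where
  "cylinder_C1 i \<Psi> \<Psi>' \<longleftrightarrow>
     (\<exists>J. finite J \<and> (\<forall>u v. (\<forall>j\<in>J. X j u = X j v) \<longrightarrow> \<Psi> u = \<Psi> v)) \<and>
     continuous_on UNIV \<Psi> \<and> continuous_on UNIV \<Psi>' \<and> bounded (range \<Psi>) \<and> bounded (range \<Psi>') \<and>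
     (\<forall>u. ((\<lambda>t. \<Psi> (u + t *\<^sub>R b i)) has_real_derivative \<Psi>' u) (at 0))"

lemma cylinder_C1_has_derivative:
  assumes "cylinder_C1 i \<Psi> \<Psi>'"
  shows "((\<lambda>t. \<Psi> (u + t *\<^sub>R b i)) has_real_derivative \<Psi>' (u + t *\<^sub>R b i)) (at t)"
proof -
  have "((\<lambda>r. \<Psi> ((u + t *\<^sub>R b i) + r *\<^sub>R b i)) has_real_derivative \<Psi>' (u + t *\<^sub>R b i)) (at 0)"
    using assms by (simp add: cylinder_C1_def)
  then have "((\<lambda>r. \<Psi> (u + (t + r) *\<^sub>R b i)) has_real_derivative \<Psi>' (u + t *\<^sub>R b i)) (at 0)"
    by (simp add: algebra_simps)
  then show ?thesis
    using DERIV_shift[of "\<lambda>r. \<Psi> (u + r *\<^sub>R b i)" _ 0 t] by (simp add: add.commute)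
qed

lemma cylinder_C1_mult:
  assumes 1: "cylinder_C1 i \<Psi> \<Psi>'" and 2: "cylinder_C1 i \<Theta> \<Theta>'"
  shows "cylinder_C1 i (\<lambda>u. \<Psi> u * \<Theta> u) (\<lambda>u. \<Psi>' u * \<Theta> u + \<Psi> u * \<Theta>' u)"
proof -
  obtain J K where "finite J" "\<forall>u v. (\<forall>j\<in>J. X j u = X j v) \<longrightarrow> \<Psi> u = \<Psi> v"
    "finite K" "\<forall>u v. (\<forall>j\<in>K. X j u = X j v) \<longrightarrow> \<Theta> u = \<Theta> v"
    using 1 2 by (auto simp: cylinder_C1_def)
  then have "finite (J \<union> K) \<and> (\<forall>u v. (\<forall>j\<in>J \<union> K. X j u = X j v) \<longrightarrow> \<Psi> u * \<Theta> u = \<Psi> v * \<Theta> v)"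
    by (metis UnCI finite_Un)
  moreover have "((\<lambda>t. \<Psi> (u + t *\<^sub>R b i) * \<Theta> (u + t *\<^sub>R b i)) has_real_derivative \<Psi>' u * \<Theta> u + \<Psi> u * \<Theta>' u) (at 0)" for u
    using cylinder_C1_has_derivative[OF 1, of u 0] cylinder_C1_has_derivative[OF 2, of u 0]
    by (auto intro!: derivative_eq_intros)
  ultimately show ?thesis
    using 1 2 unfolding cylinder_C1_def
    by (intro conjI exI[of _ "J \<union> K"] allI continuous_intros bounded_plus_comp bounded_range_mult) auto
qed

text \<open>\<open>\<Psi>\<close> takes values in a compact interval, so continuity of
  \<open>\<psi>\<close> and \<open>\<psi>'\<close> already makes the compositions bounded.\<close>

lemma cylinder_C1_compose:
  fixes \<psi> \<psi>' :: "real \<Rightarrow> real"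
  assumes 1: "cylinder_C1 i \<Psi> \<Psi>'" and der: "\<And>t. (\<psi> has_real_derivative \<psi>' t) (at t)"
    and cont: "continuous_on UNIV \<psi>'"
  shows "cylinder_C1 i (\<lambda>u. \<psi> (\<Psi> u)) (\<lambda>u. \<psi>' (\<Psi> u) * \<Psi>' u)"
proof -
  obtain B where B: "\<And>u. \<bar>\<Psi> u\<bar> \<le> B" using 1 by (auto simp: cylinder_C1_def bounded_iff)
  have bdd: "bounded (range (\<lambda>u. g (\<Psi> u)))" if "continuous_on UNIV g" for g :: "real \<Rightarrow> real"
  proof -
    have "compact (g ` {-B..B})"
      using that continuous_on_subset by (intro compact_continuous_image) blast+
    moreover have "range (\<lambda>u. g (\<Psi> u)) \<subseteq> g ` {-B..B}" using B by (auto simp: abs_le_iff minus_le_iff)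
    ultimately show ?thesis using bounded_subset compact_imp_bounded by blast
  qed
  have cont\<psi>: "continuous_on UNIV \<psi>"
    using der by (meson DERIV_continuous continuous_at_imp_continuous_on)
  have "bounded (range (\<lambda>u. \<psi>' (\<Psi> u) * \<Psi>' u))"
    using bounded_range_mult[OF bdd[OF cont]] 1 by (simp add: cylinder_C1_def)
  moreover have "((\<lambda>t. \<psi> (\<Psi> (u + t *\<^sub>R b i))) has_real_derivative \<psi>' (\<Psi> u) * \<Psi>' u) (at 0)" for u
    using DERIV_chain2[OF der cylinder_C1_has_derivative[OF 1, of u 0]] by simp
  moreover have "continuous_on UNIV (\<lambda>u. \<psi> (\<Psi> u))" "continuous_on UNIV (\<lambda>u. \<psi>' (\<Psi> u) * \<Psi>' u)"
    using 1 cont cont\<psi> unfolding cylinder_C1_def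
    by (auto intro!: continuous_intros intro: continuous_on_compose2[of UNIV])
  moreover obtain J where "finite J" "\<forall>u v. (\<forall>j\<in>J. X j u = X j v) \<longrightarrow> \<Psi> u = \<Psi> v"
    using 1 by (auto simp: cylinder_C1_def)
  ultimately show ?thesis
    using bdd[OF cont\<psi>] unfolding cylinder_C1_def by metis
qed

text \<open>\<open>\<Psi>\<close> depends on the standardized coordinate \<open>i\<close> and on an
  independent finite family of other coordinates. With the family frozen, differentiation along
  \<open>b i\<close> becomes differentiation in one normal variable.\<close>

lemma integration_by_parts:
  assumes C1: "cylinder_C1 i \<Psi> \<Psi>'"
  shows "expectation \<Psi>' = \<kappa> i * expectation (\<lambda>u. X i u * \<Psi> u)"
proof -
  obtain J where J: "finite J" and cyl: "\<And>u v. (\<And>j. j \<in> J \<Longrightarrow> X j u = X j v) \<Longrightarrow> \<Psi> u = \<Psi> v"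
    using C1 by (auto simp: cylinder_C1_def)
  \<comment> \<open>Translation along \<open>b i\<close> changes the coordinates of both points by
    the same amounts, so agreement on \<open>J\<close> persists along the two lines and their
    derivatives agree.\<close>
  have cyl': "\<Psi>' u = \<Psi>' v" if "\<And>j. j \<in> J \<Longrightarrow> X j u = X j v" for u v
  proof -
    have "\<Psi> (u + t *\<^sub>R b i) = \<Psi> (v + t *\<^sub>R b i)" for t
      using that by (intro cyl) (auto simp: X_line)
    then show ?thesis
      using cylinder_C1_has_derivative[OF C1, of u 0] cylinder_C1_has_derivative[OF C1, of v 0]
      by (auto intro: DERIV_unique)
  qed
  let ?K = "J - {i}"
  define s where "s j = sqrt (\<kappa> j)" for j
  have s: "s j > 0" "s j * s j = \<kappa> j" for j using \<kappa>_pos[of j] by (auto simp: s_def)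
  define N where "N = (\<Pi>\<^sub>M j\<in>?K. (borel :: real measure))"
  define Y where "Y u = (\<lambda>j\<in>?K. s j * X j u)" for u
  \<comment> \<open>A right inverse of the coordinate map: it rebuilds a point from its standardized
    coordinates. The result agrees with the original point only on \<open>J\<close>, which is all
    that \<open>\<Psi>\<close> and \<open>\<Psi>'\<close> can see.\<close>
  define p where "p z y = (\<Sum>j\<in>?K. (y j / s j) *\<^sub>R b j) + (z / s i) *\<^sub>R b i" for z :: real and y :: "'i \<Rightarrow> real"
  have [measurable]: "\<Psi> \<in> borel_measurable borel" "\<Psi>' \<in> borel_measurable borel"
    using C1 by (auto simp: cylinder_C1_def intro: borel_measurable_continuous_onI)
  have p_meas [measurable]: "case_prod p \<in> borel_measurable (borel \<Otimes>\<^sub>M N)"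
    unfolding p_def N_def by measurable
  have X_p: "X j (p (s i * X i u) (Y u)) = X j u" if "j \<in> J" for j u
    using that J s(1) less_imp_neq[OF s(1)]
    by (auto simp: p_def Y_def X_add X_sum X_scaleR X_b if_distrib[of "(*) _"] sum.delta' cong: if_cong)
  have \<Psi>_p: "\<Psi> (p (s i * X i u) (Y u)) = \<Psi> u" and \<Psi>'_p: "\<Psi>' (p (s i * X i u) (Y u)) = \<Psi>' u" for u
    by (auto intro!: cyl cyl' X_p)
  obtain B B' where B: "\<And>u. \<bar>\<Psi> u\<bar> \<le> B" and B': "\<And>u. \<bar>\<Psi>' u\<bar> \<le> B'"
    using C1 by (auto simp: cylinder_C1_def bounded_iff)
  define W where "W u = (\<lambda>j\<in>{i}. s j * X j u)" for u
  have W: "W u i = s i * X i u" for u by (simp add: W_def)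
  have indep: "indep_var (PiM {i} (\<lambda>_. borel)) W N Y"
    unfolding N_def Y_def W_def s_def
    by (rule indep_var_restrict[OF indep_vars_standardized[of "insert i J"]]) (use J in auto)
  have "expectation (\<lambda>u. \<Psi>' (p (s i * X i u) (Y u)) / s i)
      = expectation (\<lambda>u. s i * X i u * \<Psi> (p (s i * X i u) (Y u)))"
  proof (rule std_normal_independent_integration_by_parts[OF indep, of "\<lambda>w. w i", unfolded W])
    show "distr M borel (\<lambda>u. s i * X i u) = std_normal_distribution"
      unfolding s_def by (rule distr_standardized)
    show "((\<lambda>z. \<Psi> (p z y)) has_real_derivative \<Psi>' (p z y) / s i) (at z)" for z y
      unfolding p_def
      by (rule DERIV_chain2[where g = "\<lambda>z. z / s i" and Db = "1 / s i", OF cylinder_C1_has_derivative[OF C1], simplified])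
        (use s(1)[of i] in \<open>auto intro!: derivative_eq_intros\<close>)
    show "continuous_on UNIV (\<lambda>z. \<Psi>' (p z y) / s i)" for y
      using C1 s(1)[of i] unfolding p_def cylinder_C1_def
      by (auto intro!: continuous_intros intro: continuous_on_compose2[of UNIV])
    show "\<bar>\<Psi>' (p z y) / s i\<bar> \<le> B' / s i" for z y
      using B' s(1)[of i] by (simp add: divide_right_mono)
  qed (use B in measurable)
  \<comment> \<open>One factor \<open>s i\<close> stems from the inner derivative
    \<open>1 / s i\<close>, the other from the standardized coordinate; together they give
    \<open>\<kappa> i\<close>.\<close>
  then have "expectation \<Psi>' / s i = s i * expectation (\<lambda>u. X i u * \<Psi> u)"
    by (simp add: \<Psi>_p \<Psi>'_p mult.assoc)
  then show ?thesis using s[of i] by (simp add: field_simps flip: s(2))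
qed

end

section \<open>Integration by parts against an exponential weight\<close>

lemma Cauchy_Schwarz_integral:
  fixes f g :: "'a \<Rightarrow> real"
  assumes [measurable]: "f \<in> borel_measurable M" "g \<in> borel_measurable M"
    and f: "integrable M (\<lambda>x. (f x)\<^sup>2)" and g: "integrable M (\<lambda>x. (g x)\<^sup>2)"
  shows "integrable M (\<lambda>x. f x * g x)"
    and "(\<integral>x. \<bar>f x * g x\<bar> \<partial>M) \<le> sqrt (\<integral>x. (f x)\<^sup>2 \<partial>M) * sqrt (\<integral>x. (g x)\<^sup>2 \<partial>M)"
proof -
  show int: "integrable M (\<lambda>x. f x * g x)"
  proof (rule Bochner_Integration.integrable_bound)
    show "integrable M (\<lambda>x. (f x)\<^sup>2 + (g x)\<^sup>2)" using f g by simp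
    have "\<bar>f x * g x\<bar> \<le> (f x)\<^sup>2 + (g x)\<^sup>2" for x
    proof -
      have "2 * (\<bar>f x\<bar> * \<bar>g x\<bar>) \<le> (f x)\<^sup>2 + (g x)\<^sup>2"
        using sum_squares_bound[of "\<bar>f x\<bar>" "\<bar>g x\<bar>"] by simp
      then show ?thesis using mult_nonneg_nonneg[OF abs_ge_zero[of "f x"] abs_ge_zero[of "g x"]] unfolding abs_mult by linarith
    qed
    then show "AE x in M. norm (f x * g x) \<le> norm ((f x)\<^sup>2 + (g x)\<^sup>2)" by simp
  qed simp
  have "(\<integral>\<^sup>+x. ennreal \<bar>f x\<bar> * ennreal \<bar>g x\<bar> \<partial>M)\<^sup>2
      \<le> (\<integral>\<^sup>+x. (ennreal \<bar>f x\<bar>)\<^sup>2 \<partial>M) * (\<integral>\<^sup>+x. (ennreal \<bar>g x\<bar>)\<^sup>2 \<partial>M)"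
    by (rule Cauchy_Schwarz_nn_integral) auto
  also have "(\<integral>\<^sup>+x. ennreal \<bar>f x\<bar> * ennreal \<bar>g x\<bar> \<partial>M) = ennreal (\<integral>x. \<bar>f x * g x\<bar> \<partial>M)"
    using integrable_abs[OF int] by (subst nn_integral_eq_integral[symmetric]) (auto simp: abs_mult ennreal_mult)
  also have "(\<integral>\<^sup>+x. (ennreal \<bar>f x\<bar>)\<^sup>2 \<partial>M) = ennreal (\<integral>x. (f x)\<^sup>2 \<partial>M)"
    using f by (subst nn_integral_eq_integral[symmetric]) (auto simp: ennreal_power)
  also have "(\<integral>\<^sup>+x. (ennreal \<bar>g x\<bar>)\<^sup>2 \<partial>M) = ennreal (\<integral>x. (g x)\<^sup>2 \<partial>M)"
    using g by (subst nn_integral_eq_integral[symmetric]) (auto simp: ennreal_power)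
  finally have "(\<integral>x. \<bar>f x * g x\<bar> \<partial>M)\<^sup>2 \<le> (\<integral>x. (f x)\<^sup>2 \<partial>M) * (\<integral>x. (g x)\<^sup>2 \<partial>M)"
    by (simp add: ennreal_power flip: ennreal_mult)
  then show "(\<integral>x. \<bar>f x * g x\<bar> \<partial>M) \<le> sqrt (\<integral>x. (f x)\<^sup>2 \<partial>M) * sqrt (\<integral>x. (g x)\<^sup>2 \<partial>M)"
    unfolding real_sqrt_mult[symmetric] by (rule real_le_rsqrt)
qed

lemma tendsto_integral_mult_if_L2:
  fixes f :: "nat \<Rightarrow> 'a \<Rightarrow> real" and g :: "'a \<Rightarrow> real"
  assumes [measurable]: "\<And>n. f n \<in> borel_measurable M" "g \<in> borel_measurable M"
    and f: "\<And>n. integrable M (\<lambda>x. (f n x)\<^sup>2)" and g: "integrable M (\<lambda>x. (g x)\<^sup>2)"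
    and lim: "(\<lambda>n. \<integral>x. (f n x)\<^sup>2 \<partial>M) \<longlonglongrightarrow> 0"
  shows "(\<lambda>n. \<integral>x. \<bar>f n x * g x\<bar> \<partial>M) \<longlonglongrightarrow> 0"
proof (rule Lim_null_comparison)
  show "\<forall>\<^sub>F n in sequentially. norm (\<integral>x. \<bar>f n x * g x\<bar> \<partial>M)
      \<le> sqrt (\<integral>x. (f n x)\<^sup>2 \<partial>M) * sqrt (\<integral>x. (g x)\<^sup>2 \<partial>M)"
    using Cauchy_Schwarz_integral(2)[OF _ _ f g] by simp
  have "(\<lambda>n. sqrt (\<integral>x. (f n x)\<^sup>2 \<partial>M) * sqrt (\<integral>x. (g x)\<^sup>2 \<partial>M)) \<longlonglongrightarrow> sqrt 0 * sqrt (\<integral>x. (g x)\<^sup>2 \<partial>M)"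
    by (intro tendsto_intros lim)
  then show "(\<lambda>n. sqrt (\<integral>x. (f n x)\<^sup>2 \<partial>M) * sqrt (\<integral>x. (g x)\<^sup>2 \<partial>M)) \<longlonglongrightarrow> 0" by simp
qed

lemma tendsto_integral_if_dominated_difference:
  fixes g :: "'a \<Rightarrow> real"
  assumes "\<And>n. integrable M (gs n)" "integrable M g" "\<And>n. integrable M (r n)"
    and bound: "\<And>n x. \<bar>gs n x - g x\<bar> \<le> r n x"
    and lim: "(\<lambda>n. \<integral>x. r n x \<partial>M) \<longlonglongrightarrow> 0"
  shows "(\<lambda>n. \<integral>x. gs n x \<partial>M) \<longlonglongrightarrow> (\<integral>x. g x \<partial>M)"
proof (rule Lim_transform2[of "\<lambda>_. \<integral>x. g x \<partial>M"])
  show "(\<lambda>n. (\<integral>x. g x \<partial>M) - (\<integral>x. gs n x \<partial>M)) \<longlonglongrightarrow> 0"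
  proof (rule Lim_null_comparison[OF _ lim], intro always_eventually allI)
    fix n
    have "norm ((\<integral>x. g x \<partial>M) - (\<integral>x. gs n x \<partial>M)) = \<bar>\<integral>x. gs n x - g x \<partial>M\<bar>"
      using assms by simp
    also have "\<dots> \<le> (\<integral>x. \<bar>gs n x - g x\<bar> \<partial>M)" by (rule integral_abs_bound)
    also have "\<dots> \<le> (\<integral>x. r n x \<partial>M)"
      by (intro integral_mono) (use assms in auto)
    finally show "norm ((\<integral>x. g x \<partial>M) - (\<integral>x. gs n x \<partial>M)) \<le> (\<integral>x. r n x \<partial>M)" .
  qed
qed simp

lemma lipschitz_if_derivative_bounded:
  fixes f f' :: "real \<Rightarrow> real"
  assumes "\<And>t. (f has_real_derivative f' t) (at t)" "\<And>t. \<bar>f' t\<bar> \<le> L"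
  shows "\<bar>f x - f y\<bar> \<le> L * \<bar>x - y\<bar>"
  using field_differentiable_bound[of UNIV f f' L x y] assms by (auto simp: has_field_derivative_at_within)

context gaussian_coordinates
begin

text \<open>The identity is exact for each \<open>hs n\<close>, since
  \<open>K u * \<psi> (hs n u)\<close> is again a bounded C1 cylinder function. The bounds on
  \<open>\<psi>\<close>, \<open>\<psi>'\<close> and the Lipschitz constant \<open>L'\<close> are
  those needed for every term to converge in mean.\<close>

lemma integration_by_parts_chain_rule:
  fixes h Dh :: "'k \<Rightarrow> real" and hs Ds :: "nat \<Rightarrow> 'k \<Rightarrow> real" and \<psi> \<psi>' :: "real \<Rightarrow> real"
  assumes K: "cylinder_C1 i K K'" and XK: "bounded (range (\<lambda>u. X i u * K u))"
    and hs: "\<And>n. cylinder_C1 i (hs n) (Ds n)"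
    and [measurable]: "h \<in> borel_measurable borel" "Dh \<in> borel_measurable borel"
    and h2: "\<And>n. integrable M (\<lambda>u. (hs n u - h u)\<^sup>2)"
    and D2: "integrable M (\<lambda>u. (Dh u)\<^sup>2)" "\<And>n. integrable M (\<lambda>u. (Ds n u - Dh u)\<^sup>2)"
    and lim_h: "(\<lambda>n. \<integral>u. (hs n u - h u)\<^sup>2 \<partial>M) \<longlonglongrightarrow> 0"
    and lim_D: "(\<lambda>n. \<integral>u. (Ds n u - Dh u)\<^sup>2 \<partial>M) \<longlonglongrightarrow> 0"
    and der: "\<And>t. (\<psi> has_real_derivative \<psi>' t) (at t)"
    and \<psi>: "\<And>t. \<bar>\<psi> t\<bar> \<le> C" and \<psi>': "\<And>t. \<bar>\<psi>' t\<bar> \<le> L"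
    and lip: "\<And>x y. \<bar>\<psi>' x - \<psi>' y\<bar> \<le> L' * \<bar>x - y\<bar>"
  shows "(\<integral>u. K' u * \<psi> (h u) \<partial>M) + (\<integral>u. K u * (\<psi>' (h u) * Dh u) \<partial>M)
    = \<kappa> i * (\<integral>u. X i u * K u * \<psi> (h u) \<partial>M)"
proof -
  have cont\<psi>': "continuous_on UNIV \<psi>'"
    unfolding continuous_on_iff
  proof (intro ballI allI impI)
    fix x e :: real assume "e > 0"
    have "\<bar>L'\<bar> + 1 > 0" by simp
    show "\<exists>d>0. \<forall>y\<in>UNIV. dist y x < d \<longrightarrow> dist (\<psi>' y) (\<psi>' x) < e"
    proof (intro exI[of _ "e / (\<bar>L'\<bar> + 1)"] conjI ballI impI)
      fix y assume y: "dist y x < e / (\<bar>L'\<bar> + 1)"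
      have "dist (\<psi>' y) (\<psi>' x) \<le> (\<bar>L'\<bar> + 1) * \<bar>y - x\<bar>"
        unfolding dist_real_def by (rule order_trans[OF lip]) (auto intro!: mult_right_mono)
      also have "\<dots> < e" using y \<open>\<bar>L'\<bar> + 1 > 0\<close> by (simp add: dist_real_def field_simps)
      finally show "dist (\<psi>' y) (\<psi>' x) < e" .
    qed (use \<open>e > 0\<close> in simp)
  qed
  have cont\<psi>: "continuous_on UNIV \<psi>"
    using der by (meson DERIV_continuous continuous_at_imp_continuous_on)
  have [measurable]: "\<psi> \<in> borel_measurable borel" "\<psi>' \<in> borel_measurable borel"
    "K \<in> borel_measurable borel" "K' \<in> borel_measurable borel"
    "hs n \<in> borel_measurable borel" "Ds n \<in> borel_measurable borel" for n
    using cont\<psi> cont\<psi>' K hs by (auto simp: cylinder_C1_def intro: borel_measurable_continuous_onI)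
  obtain B B' B'' where B: "\<And>u. \<bar>K u\<bar> \<le> B" "\<And>u. \<bar>K' u\<bar> \<le> B'" "\<And>u. \<bar>X i u * K u\<bar> \<le> B''"
    using K XK by (auto simp: cylinder_C1_def bounded_iff)
  then have B0: "B \<ge> 0" "B' \<ge> 0" "B'' \<ge> 0"
    using order_trans[OF abs_ge_zero] by blast+
  have L0: "L \<ge> 0" "C \<ge> 0" using order_trans[OF abs_ge_zero] \<psi> \<psi>' by blast+
  have int_D: "integrable M Dh"
    using Cauchy_Schwarz_integral(1)[OF _ _ D2(1), where g = "\<lambda>_. 1"] by simp
  have int_Ds: "integrable M (Ds n)" for n
  proof -
    obtain d where "\<And>u. \<bar>Ds n u\<bar> \<le> d" using hs[of n] by (auto simp: cylinder_C1_def bounded_iff)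
    then show ?thesis by (intro integrable_const_bound[of _ d]) auto
  qed
  have dh: "integrable M (\<lambda>u. \<bar>hs n u - h u\<bar>)" "integrable M (\<lambda>u. \<bar>Ds n u - Dh u\<bar>)"
    "integrable M (\<lambda>u. \<bar>(hs n u - h u) * Dh u\<bar>)" for n
    using Cauchy_Schwarz_integral(1)[OF _ _ h2[of n], where g = "\<lambda>_. 1"] Cauchy_Schwarz_integral(1)[OF _ _ h2[of n] D2(1)]
      Cauchy_Schwarz_integral(1)[OF _ _ D2(2)[of n], where g = "\<lambda>_. 1"] by auto
  \<comment> \<open>Pairing with the constant 1 turns L2 into L1 convergence on the probability
    space. The third limit pairs \<open>hs n u - h u\<close> with \<open>Dh u\<close> and uses that
    both are square integrable.\<close>
  have lims: "(\<lambda>n. \<integral>u. \<bar>hs n u - h u\<bar> \<partial>M) \<longlonglongrightarrow> 0" "(\<lambda>n. \<integral>u. \<bar>Ds n u - Dh u\<bar> \<partial>M) \<longlonglongrightarrow> 0"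
    "(\<lambda>n. \<integral>u. \<bar>(hs n u - h u) * Dh u\<bar> \<partial>M) \<longlonglongrightarrow> 0"
    using tendsto_integral_mult_if_L2[OF _ _ h2 _ lim_h, where g = "\<lambda>_. 1"] tendsto_integral_mult_if_L2[OF _ _ D2(2) _ lim_D, where g = "\<lambda>_. 1"]
      tendsto_integral_mult_if_L2[OF _ _ h2 D2(1) lim_h] by simp_all
  \<comment> \<open>Needed for \<open>g = K'\<close> and for \<open>g\<close> the product of
    \<open>X i\<close> and \<open>K\<close>; the second case is the reason for the hypothesis
    \<open>XK\<close>.\<close>
  have lipschitz_lim: "(\<lambda>n. \<integral>u. g u * \<psi> (hs n u) \<partial>M) \<longlonglongrightarrow> (\<integral>u. g u * \<psi> (h u) \<partial>M)"
    and int_g: "integrable M (\<lambda>u. g u * \<psi> (hs n u))"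
    if [measurable]: "g \<in> borel_measurable borel" and g: "\<And>u. \<bar>g u\<bar> \<le> b" for g b n
  proof -
    have b0: "b \<ge> 0" using order_trans[OF abs_ge_zero g] .
    have int: "integrable M (\<lambda>u. g u * \<psi> (k u))" if [measurable]: "k \<in> borel_measurable borel" for k
      by (rule integrable_const_bound[of _ "b * C"]) (use g \<psi> b0 in \<open>auto simp: abs_mult intro!: mult_mono\<close>)
    then show "integrable M (\<lambda>u. g u * \<psi> (hs n u))" by simp
    show "(\<lambda>n. \<integral>u. g u * \<psi> (hs n u) \<partial>M) \<longlonglongrightarrow> (\<integral>u. g u * \<psi> (h u) \<partial>M)"
    proof (rule tendsto_integral_if_dominated_difference)
      fix n u
      show "\<bar>g u * \<psi> (hs n u) - g u * \<psi> (h u)\<bar> \<le> b * (L * \<bar>hs n u - h u\<bar>)"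
        unfolding right_diff_distrib[symmetric] abs_mult
        using b0 g lipschitz_if_derivative_bounded[OF der \<psi>'] by (intro mult_mono) auto
      show "integrable M (\<lambda>u. b * (L * \<bar>hs n u - h u\<bar>))" using dh by simp
    next
      show "(\<lambda>n. \<integral>u. b * (L * \<bar>hs n u - h u\<bar>) \<partial>M) \<longlonglongrightarrow> 0"
        using tendsto_mult_left[OF lims(1), of "b * L"] by (simp add: mult.assoc)
    qed (use int in auto)
  qed
  have int_KD: "integrable M (\<lambda>u. K u * (\<psi>' (k u) * d u))"
    if [measurable]: "k \<in> borel_measurable borel" and d: "integrable M d" for k d
  proof (rule Bochner_Integration.integrable_bound)
    show "integrable M (\<lambda>u. B * (L * d u))" using d by simp
    have [measurable]: "d \<in> borel_measurable borel" using d by simp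
    show "(\<lambda>u. K u * (\<psi>' (k u) * d u)) \<in> borel_measurable M" by measurable
    show "AE u in M. norm (K u * (\<psi>' (k u) * d u)) \<le> norm (B * (L * d u))"
      using B(1) \<psi>' B0 L0 by (auto simp: abs_mult intro!: AE_I2 mult_mono)
  qed
  have "(\<lambda>n. \<integral>u. K u * (\<psi>' (hs n u) * Ds n u) \<partial>M) \<longlonglongrightarrow> (\<integral>u. K u * (\<psi>' (h u) * Dh u) \<partial>M)"
  proof (rule tendsto_integral_if_dominated_difference)
    fix n u
    \<comment> \<open>The split leaves the limit \<open>Dh\<close> beside the difference of the
      values of \<open>\<psi>'\<close>, so this term is controlled by \<open>L'\<close> and the
      third limit, while the other needs only the bound \<open>L\<close>.\<close>
    have "\<psi>' (hs n u) * Ds n u - \<psi>' (h u) * Dh u = \<psi>' (hs n u) * (Ds n u - Dh u) + (\<psi>' (hs n u) - \<psi>' (h u)) * Dh u"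
      by (simp add: algebra_simps)
    also have "\<bar>\<dots>\<bar> \<le> L * \<bar>Ds n u - Dh u\<bar> + L' * \<bar>hs n u - h u\<bar> * \<bar>Dh u\<bar>"
      by (rule order_trans[OF abs_triangle_ineq])
        (auto simp: abs_mult intro!: add_mono mult_right_mono \<psi>' lip)
    finally show "\<bar>K u * (\<psi>' (hs n u) * Ds n u) - K u * (\<psi>' (h u) * Dh u)\<bar>
        \<le> B * (L * \<bar>Ds n u - Dh u\<bar> + L' * \<bar>(hs n u - h u) * Dh u\<bar>)"
      unfolding right_diff_distrib[symmetric] abs_mult mult.assoc
      using B(1) B0 by (intro mult_mono) auto
    show "integrable M (\<lambda>u. B * (L * \<bar>Ds n u - Dh u\<bar> + L' * \<bar>(hs n u - h u) * Dh u\<bar>))"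
      by (intro integrable_mult_right Bochner_Integration.integrable_add dh)
  next
    have "(\<lambda>n. B * (L * (\<integral>u. \<bar>Ds n u - Dh u\<bar> \<partial>M) + L' * (\<integral>u. \<bar>(hs n u - h u) * Dh u\<bar> \<partial>M))) \<longlonglongrightarrow> B * (L * 0 + L' * 0)"
      by (intro tendsto_intros lims)
    moreover have "(\<integral>u. B * (L * \<bar>Ds n u - Dh u\<bar> + L' * \<bar>(hs n u - h u) * Dh u\<bar>) \<partial>M)
      = B * (L * (\<integral>u. \<bar>Ds n u - Dh u\<bar> \<partial>M) + L' * (\<integral>u. \<bar>(hs n u - h u) * Dh u\<bar> \<partial>M))" for n
      unfolding integral_mult_right_zero
      by (subst Bochner_Integration.integral_add) (auto intro!: integrable_mult_right dh simp del: abs_mult)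
    ultimately show "(\<lambda>n. \<integral>u. B * (L * \<bar>Ds n u - Dh u\<bar> + L' * \<bar>(hs n u - h u) * Dh u\<bar>) \<partial>M) \<longlonglongrightarrow> 0"
      by (simp only: add_0_right mult_zero_right)
  qed (use int_KD int_D int_Ds in auto)
  moreover have "(\<lambda>n. \<integral>u. K' u * \<psi> (hs n u) \<partial>M) \<longlonglongrightarrow> (\<integral>u. K' u * \<psi> (h u) \<partial>M)"
    by (rule lipschitz_lim[OF _ B(2)]) simp
  ultimately have "(\<lambda>n. (\<integral>u. K' u * \<psi> (hs n u) \<partial>M) + (\<integral>u. K u * (\<psi>' (hs n u) * Ds n u) \<partial>M))
    \<longlonglongrightarrow> (\<integral>u. K' u * \<psi> (h u) \<partial>M) + (\<integral>u. K u * (\<psi>' (h u) * Dh u) \<partial>M)"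
    by (rule tendsto_add[rotated])
  moreover have "(\<lambda>n. \<kappa> i * (\<integral>u. X i u * K u * \<psi> (hs n u) \<partial>M)) \<longlonglongrightarrow> \<kappa> i * (\<integral>u. X i u * K u * \<psi> (h u) \<partial>M)"
    by (intro tendsto_mult_left lipschitz_lim[OF _ B(3)]) simp
  moreover have "(\<integral>u. K' u * \<psi> (hs n u) \<partial>M) + (\<integral>u. K u * (\<psi>' (hs n u) * Ds n u) \<partial>M)
      = \<kappa> i * (\<integral>u. X i u * K u * \<psi> (hs n u) \<partial>M)" for n
  proof -
    have "(\<integral>u. K' u * \<psi> (hs n u) + K u * (\<psi>' (hs n u) * Ds n u) \<partial>M)
      = \<kappa> i * (\<integral>u. X i u * (K u * \<psi> (hs n u)) \<partial>M)"
      by (rule integration_by_parts[OF cylinder_C1_mult[OF K cylinder_C1_compose[OF hs der cont\<psi>']]])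
    then show ?thesis
      using int_g[OF _ B(2)] int_KD[OF _ int_Ds[of n], of "hs n"] by (simp add: mult.assoc)
  qed
  ultimately show ?thesis
    using LIMSEQ_unique by simp
qed

text \<open>The exponential weight is unbounded, so it is approximated by \<open>1 / (exp (\<beta> h) + \<epsilon>)\<close>; this
  function of \<open>h\<close> and its first two derivatives are bounded, and it and its first derivative are dominated by
  multiples of \<open>exp (- \<beta> h)\<close> uniformly in \<open>\<epsilon>\<close>.\<close>

lemma integration_by_parts_exp:
  fixes h Dh :: "'k \<Rightarrow> real" and hs Ds :: "nat \<Rightarrow> 'k \<Rightarrow> real"
  assumes K: "cylinder_C1 i K K'" and XK: "bounded (range (\<lambda>u. X i u * K u))"
    and hs: "\<And>n. cylinder_C1 i (hs n) (Ds n)"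
    and [measurable]: "h \<in> borel_measurable borel" "Dh \<in> borel_measurable borel"
    and h2: "\<And>n. integrable M (\<lambda>u. (hs n u - h u)\<^sup>2)"
    and D2: "integrable M (\<lambda>u. (Dh u)\<^sup>2)" "\<And>n. integrable M (\<lambda>u. (Ds n u - Dh u)\<^sup>2)"
    and lim_h: "(\<lambda>n. \<integral>u. (hs n u - h u)\<^sup>2 \<partial>M) \<longlonglongrightarrow> 0"
    and lim_D: "(\<lambda>n. \<integral>u. (Ds n u - Dh u)\<^sup>2 \<partial>M) \<longlonglongrightarrow> 0"
    and "\<beta> > 0" and int: "integrable M (\<lambda>u. exp (- \<beta> * h u))"
    and int_D: "integrable M (\<lambda>u. Dh u * exp (- \<beta> * h u))"
  shows "(\<integral>u. K' u * exp (- \<beta> * h u) \<partial>M)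
    = \<kappa> i * (\<integral>u. X i u * K u * exp (- \<beta> * h u) \<partial>M) + \<beta> * (\<integral>u. K u * (Dh u * exp (- \<beta> * h u)) \<partial>M)"
proof -
  define \<epsilon> where "\<epsilon> n = inverse (real (Suc n))" for n
  have \<epsilon>: "\<epsilon> n > 0" for n by (simp add: \<epsilon>_def)
  have lim\<epsilon>: "\<epsilon> \<longlonglongrightarrow> 0" unfolding \<epsilon>_def by (rule LIMSEQ_inverse_real_of_nat)
  define \<psi> where "\<psi> n t = 1 / (exp (\<beta> * t) + \<epsilon> n)" for n t
  define \<psi>' where "\<psi>' n t = - \<beta> * exp (\<beta> * t) / (exp (\<beta> * t) + \<epsilon> n)\<^sup>2" for n t
  define \<psi>'' where "\<psi>'' n t = - \<beta> * (\<psi>' n t * (1 - 2 * (\<epsilon> n * \<psi> n t)))" for n t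
  have pos: "exp (\<beta> * t) + \<epsilon> n > 0" for n t using \<epsilon>[of n] by (simp add: add_pos_pos)
  have der: "(\<psi> n has_real_derivative \<psi>' n t) (at t)" for n t
    unfolding \<psi>_def \<psi>'_def using pos[of t n]
    by (auto intro!: derivative_eq_intros simp: power2_eq_square)
  \<comment> \<open>This writes \<open>\<psi>' n\<close> as a polynomial in \<open>\<psi> n\<close>,
    with \<open>x\<close> standing for \<open>exp (\<beta> * t)\<close> and \<open>r\<close> for
    \<open>\<epsilon> n\<close>; the second derivative and its bound then follow from those of
    \<open>\<psi> n\<close>.\<close>
  have "- \<beta> * x / (x + r)\<^sup>2 = - \<beta> * (1 / (x + r) - r * (1 / (x + r))\<^sup>2)" if "x + r \<noteq> 0" for x r :: real
    using that by (simp add: divide_simps power2_eq_square)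
  then have "\<psi>' n = (\<lambda>t. - \<beta> * (\<psi> n t - \<epsilon> n * (\<psi> n t)\<^sup>2))" for n
    using less_imp_neq[OF pos] unfolding fun_eq_iff \<psi>_def \<psi>'_def by metis
  then have der': "(\<psi>' n has_real_derivative \<psi>'' n t) (at t)" for n t
    by (auto intro!: derivative_eq_intros der simp: \<psi>''_def algebra_simps)
  have \<psi>_le: "\<bar>\<psi> n t\<bar> \<le> exp (- \<beta> * t)" "\<bar>\<psi> n t\<bar> \<le> 1 / \<epsilon> n" for n t
    using \<epsilon>[of n] pos[of t n] by (auto simp: \<psi>_def exp_minus field_simps)
  have \<psi>'_eq: "\<bar>\<psi>' n t\<bar> \<le> \<beta> * \<bar>\<psi> n t\<bar>" for n t
  proof -
    have "\<bar>\<psi>' n t\<bar> = \<beta> * \<bar>\<psi> n t\<bar> * (exp (\<beta> * t) / (exp (\<beta> * t) + \<epsilon> n))"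
      using \<open>\<beta> > 0\<close> pos[of t n] by (simp add: \<psi>'_def \<psi>_def abs_mult power2_eq_square)
    also have "\<dots> \<le> \<beta> * \<bar>\<psi> n t\<bar> * 1"
      using \<open>\<beta> > 0\<close> pos[of t n] \<epsilon>[of n] by (intro mult_left_mono) (auto simp: field_simps)
    finally show ?thesis by simp
  qed
  have \<psi>'_le: "\<bar>\<psi>' n t\<bar> \<le> \<beta> * exp (- \<beta> * t)" "\<bar>\<psi>' n t\<bar> \<le> \<beta> * (1 / \<epsilon> n)" for n t
    using order_trans[OF \<psi>'_eq mult_left_mono[OF \<psi>_le(1)]] order_trans[OF \<psi>'_eq mult_left_mono[OF \<psi>_le(2)]] \<open>\<beta> > 0\<close>
    by auto
  have \<psi>''_le: "\<bar>\<psi>'' n t\<bar> \<le> \<beta>\<^sup>2 * (1 / \<epsilon> n)" for n t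
  proof -
    have "\<epsilon> n * \<psi> n t \<ge> 0" "\<epsilon> n * \<psi> n t \<le> 1"
      using pos[of t n] \<epsilon>[of n] by (auto simp: \<psi>_def field_simps)
    then have "\<bar>\<psi>' n t\<bar> * \<bar>1 - 2 * (\<epsilon> n * \<psi> n t)\<bar> \<le> \<beta> * (1 / \<epsilon> n) * 1"
      using \<open>\<beta> > 0\<close> \<epsilon>[of n] by (intro mult_mono \<psi>'_le) auto
    then have "\<beta> * (\<bar>\<psi>' n t\<bar> * \<bar>1 - 2 * (\<epsilon> n * \<psi> n t)\<bar>) \<le> \<beta> * (\<beta> * (1 / \<epsilon> n) * 1)"
      using \<open>\<beta> > 0\<close> by (intro mult_left_mono) auto
    then show ?thesis
      using \<open>\<beta> > 0\<close> by (simp add: \<psi>''_def abs_mult power2_eq_square)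
  qed
  \<comment> \<open>Here \<open>n\<close> is fixed, so the constants may blow up as
    \<open>\<epsilon> n\<close> tends to 0. The limits below use only the majorants that are free of
    \<open>\<epsilon> n\<close>.\<close>
  have eq: "(\<integral>u. K' u * \<psi> n (h u) \<partial>M) + (\<integral>u. K u * (\<psi>' n (h u) * Dh u) \<partial>M)
    = \<kappa> i * (\<integral>u. X i u * K u * \<psi> n (h u) \<partial>M)" for n
    by (rule integration_by_parts_chain_rule[OF K XK hs _ _ h2 D2 lim_h lim_D der \<psi>_le(2) \<psi>'_le(2)
        lipschitz_if_derivative_bounded[OF der' \<psi>''_le]]) auto
  have conv: "(\<lambda>n. \<psi> n t) \<longlonglongrightarrow> exp (- \<beta> * t)" for t
  proof -
    have "(\<lambda>n. \<psi> n t) \<longlonglongrightarrow> 1 / (exp (\<beta> * t) + 0)"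
      unfolding \<psi>_def by (intro tendsto_intros lim\<epsilon>) simp
    then show ?thesis by (simp add: exp_minus field_simps)
  qed
  have conv': "(\<lambda>n. \<psi>' n t) \<longlonglongrightarrow> - \<beta> * exp (- \<beta> * t)" for t
  proof -
    have "(\<lambda>n. \<psi>' n t) \<longlonglongrightarrow> - \<beta> * exp (\<beta> * t) / (exp (\<beta> * t) + 0)\<^sup>2"
      unfolding \<psi>'_def by (intro tendsto_intros lim\<epsilon>) simp
    then show ?thesis by (simp add: exp_minus field_simps power2_eq_square)
  qed
  have "continuous_on UNIV (\<psi> n)" "continuous_on UNIV (\<psi>' n)" for n
    using der der' by (meson DERIV_continuous continuous_at_imp_continuous_on)+
  then have [measurable]: "\<psi> n \<in> borel_measurable borel" "\<psi>' n \<in> borel_measurable borel"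
    "K \<in> borel_measurable borel" "K' \<in> borel_measurable borel" for n
    using K by (auto simp: cylinder_C1_def intro!: borel_measurable_continuous_onI)
  obtain B B' B'' where B: "\<And>u. \<bar>K u\<bar> \<le> B" "\<And>u. \<bar>K' u\<bar> \<le> B'" "\<And>u. \<bar>X i u * K u\<bar> \<le> B''"
    using K XK by (auto simp: cylinder_C1_def bounded_iff)
  then have B0: "B \<ge> 0" using order_trans[OF abs_ge_zero] by blast
  have lim: "(\<lambda>n. \<integral>u. g u * \<psi> n (h u) \<partial>M) \<longlonglongrightarrow> (\<integral>u. g u * exp (- \<beta> * h u) \<partial>M)"
    if [measurable]: "g \<in> borel_measurable borel" and g: "\<And>u. \<bar>g u\<bar> \<le> b" for g b
  proof (rule integral_dominated_convergence)
    have "b \<ge> 0" using order_trans[OF abs_ge_zero g] .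
    show "integrable M (\<lambda>u. b * exp (- \<beta> * h u))" using int by simp
    show "AE u in M. norm (g u * \<psi> n (h u)) \<le> b * exp (- \<beta> * h u)" for n
      using g \<psi>_le(1) \<open>b \<ge> 0\<close> unfolding real_norm_def abs_mult by (intro AE_I2 mult_mono) auto
    show "AE u in M. (\<lambda>n. g u * \<psi> n (h u)) \<longlonglongrightarrow> g u * exp (- \<beta> * h u)"
      by (intro AE_I2 tendsto_intros conv)
  qed auto
  have lim': "(\<lambda>n. \<integral>u. K u * (\<psi>' n (h u) * Dh u) \<partial>M) \<longlonglongrightarrow> (\<integral>u. K u * (- \<beta> * exp (- \<beta> * h u) * Dh u) \<partial>M)"
  proof (rule integral_dominated_convergence)
    \<comment> \<open>Here the integrability of the weighted gradient is indispensable as a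
      majorant: \<open>Dh\<close> lies in L2, but the weight is only known to lie in L1.\<close>
    show "integrable M (\<lambda>u. B * (\<beta> * \<bar>Dh u * exp (- \<beta> * h u)\<bar>))"
      by (intro integrable_mult_right integrable_abs int_D)
    show "AE u in M. norm (K u * (\<psi>' n (h u) * Dh u)) \<le> B * (\<beta> * \<bar>Dh u * exp (- \<beta> * h u)\<bar>)" for n
    proof (rule AE_I2)
      fix u
      have "\<bar>\<psi>' n (h u)\<bar> * \<bar>Dh u\<bar> \<le> \<beta> * exp (- \<beta> * h u) * \<bar>Dh u\<bar>"
        by (intro mult_right_mono \<psi>'_le) simp
      also have "\<dots> = \<beta> * \<bar>Dh u * exp (- \<beta> * h u)\<bar>" by (simp add: abs_mult)
      finally show "norm (K u * (\<psi>' n (h u) * Dh u)) \<le> B * (\<beta> * \<bar>Dh u * exp (- \<beta> * h u)\<bar>)"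
        unfolding real_norm_def abs_mult[of "K u"] abs_mult[of "\<psi>' n (h u)"]
        by (rule mult_mono[OF B(1)]) (use B0 in auto)
    qed
    show "AE u in M. (\<lambda>n. K u * (\<psi>' n (h u) * Dh u)) \<longlonglongrightarrow> K u * (- \<beta> * exp (- \<beta> * h u) * Dh u)"
      by (intro AE_I2 tendsto_mult tendsto_const conv')
  qed auto
  have "(\<integral>u. K u * (- \<beta> * exp (- \<beta> * h u) * Dh u) \<partial>M) = - \<beta> * (\<integral>u. K u * (Dh u * exp (- \<beta> * h u)) \<partial>M)"
    by (subst integral_mult_right_zero[symmetric]) (simp add: mult_ac)
  moreover have "(\<integral>u. K' u * exp (- \<beta> * h u) \<partial>M) + (\<integral>u. K u * (- \<beta> * exp (- \<beta> * h u) * Dh u) \<partial>M)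
      = \<kappa> i * (\<integral>u. X i u * K u * exp (- \<beta> * h u) \<partial>M)"
  proof (rule LIMSEQ_unique)
    show "(\<lambda>n. (\<integral>u. K' u * \<psi> n (h u) \<partial>M) + (\<integral>u. K u * (\<psi>' n (h u) * Dh u) \<partial>M))
      \<longlonglongrightarrow> (\<integral>u. K' u * exp (- \<beta> * h u) \<partial>M) + (\<integral>u. K u * (- \<beta> * exp (- \<beta> * h u) * Dh u) \<partial>M)"
      by (intro tendsto_add lim' lim[OF _ B(2)]) simp
    show "(\<lambda>n. (\<integral>u. K' u * \<psi> n (h u) \<partial>M) + (\<integral>u. K u * (\<psi>' n (h u) * Dh u) \<partial>M))
      \<longlonglongrightarrow> \<kappa> i * (\<integral>u. X i u * K u * exp (- \<beta> * h u) \<partial>M)"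
      unfolding eq by (intro tendsto_mult_left lim[OF _ B(3)]) simp
  qed
  ultimately show ?thesis by simp
qed

end

section \<open>Partial derivatives of test functions\<close>

text \<open>The mean value theorem is applied to the increment \<open>g s (b + h) - g s b\<close> as
  a function of \<open>s\<close>, and then to \<open>g1 \<xi>\<close>.\<close>

lemma mixed_difference_quotient:
  fixes g g1 g12 :: "real \<Rightarrow> real \<Rightarrow> real"
  assumes "h > 0"
    and g1: "\<And>s t. ((\<lambda>s. g s t) has_real_derivative g1 s t) (at s)"
    and g12: "\<And>s t. ((\<lambda>t. g1 s t) has_real_derivative g12 s t) (at t)"
  obtains \<xi> \<eta> where "a < \<xi>" "\<xi> < a + h" "b < \<eta>" "\<eta> < b + h"
    "(g (a + h) (b + h) - g (a + h) b) - (g a (b + h) - g a b) = h * h * g12 \<xi> \<eta>"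
proof -
  have "\<exists>\<xi>>a. \<xi> < a + h \<and> (g (a + h) (b + h) - g (a + h) b) - (g a (b + h) - g a b)
      = (a + h - a) * (g1 \<xi> (b + h) - g1 \<xi> b)"
    using \<open>h > 0\<close> by (intro MVT2[of a "a + h" "\<lambda>s. g s (b + h) - g s b"]) (auto intro!: derivative_eq_intros g1)
  then obtain \<xi> where \<xi>: "a < \<xi>" "\<xi> < a + h"
    "(g (a + h) (b + h) - g (a + h) b) - (g a (b + h) - g a b) = h * (g1 \<xi> (b + h) - g1 \<xi> b)"
    by auto
  have "\<exists>\<eta>>b. \<eta> < b + h \<and> g1 \<xi> (b + h) - g1 \<xi> b = (b + h - b) * g12 \<xi> \<eta>"
    using \<open>h > 0\<close> by (intro MVT2) (auto intro!: g12)
  then show thesis using \<xi> that by auto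
qed

text \<open>The second difference over a square is symmetric in the two variables. Evaluated in
  either order it is the area times a mixed derivative at some point of the square, so two different
  values at the corner would contradict continuity on a small enough square.\<close>

lemma mixed_partial_derivatives_eq:
  fixes g g1 g2 g12 g21 :: "real \<Rightarrow> real \<Rightarrow> real"
  assumes g1: "\<And>s t. ((\<lambda>s. g s t) has_real_derivative g1 s t) (at s)"
    and g2: "\<And>s t. ((\<lambda>t. g s t) has_real_derivative g2 s t) (at t)"
    and g12: "\<And>s t. ((\<lambda>t. g1 s t) has_real_derivative g12 s t) (at t)"
    and g21: "\<And>s t. ((\<lambda>s. g2 s t) has_real_derivative g21 s t) (at s)"
    and cont12: "isCont (\<lambda>(s, t). g12 s t) (a, b)" and cont21: "isCont (\<lambda>(s, t). g21 s t) (a, b)"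
  shows "g12 a b = g21 a b"
proof (rule ccontr)
  assume "g12 a b \<noteq> g21 a b"
  then have pos: "\<bar>g12 a b - g21 a b\<bar> / 2 > 0" by simp
  obtain d d' where d: "d > 0" "\<And>p. dist p (a, b) < d \<Longrightarrow> dist (g12 (fst p) (snd p)) (g12 a b) < \<bar>g12 a b - g21 a b\<bar> / 2"
    and d': "d' > 0" "\<And>p. dist p (a, b) < d' \<Longrightarrow> dist (g21 (fst p) (snd p)) (g21 a b) < \<bar>g12 a b - g21 a b\<bar> / 2"
    using cont12 cont21 pos unfolding continuous_at_eps_delta case_prod_beta by (metis fst_conv snd_conv)
  \<comment> \<open>Points of the open square with side \<open>h\<close> are closer than
    \<open>2 * h\<close> to its corner, hence the division by 2.\<close>
  define h where "h = min d d' / 2"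
  have h: "h > 0" "2 * h \<le> d" "2 * h \<le> d'" using d d' by (auto simp: h_def)
  obtain \<xi> \<eta> where 1: "a < \<xi>" "\<xi> < a + h" "b < \<eta>" "\<eta> < b + h"
    "(g (a + h) (b + h) - g (a + h) b) - (g a (b + h) - g a b) = h * h * g12 \<xi> \<eta>"
    using mixed_difference_quotient[OF h(1) g1 g12] by blast
  obtain \<eta>' \<xi>' where 2: "b < \<eta>'" "\<eta>' < b + h" "a < \<xi>'" "\<xi>' < a + h"
    "(g (a + h) (b + h) - g a (b + h)) - (g (a + h) b - g a b) = h * h * g21 \<xi>' \<eta>'"
    using mixed_difference_quotient[OF h(1), of "\<lambda>t s. g s t" "\<lambda>t s. g2 s t" "\<lambda>t s. g21 s t"] g2 g21 by blast
  have near: "dist (x, y) (a, b) < 2 * h" if "a < x" "x < a + h" "b < y" "y < b + h" for x y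
  proof -
    have "dist (x, y) (a, b) \<le> \<bar>x - a\<bar> + \<bar>y - b\<bar>"
      using sqrt_sum_squares_le_sum_abs[of "x - a" "y - b"] by (simp add: dist_Pair_Pair dist_real_def)
    then show ?thesis using that by simp
  qed
  have "g12 \<xi> \<eta> = g21 \<xi>' \<eta>'"
    using 1(5) 2(5) h(1) by (simp add: algebra_simps)
  moreover have "dist (g12 \<xi> \<eta>) (g12 a b) < \<bar>g12 a b - g21 a b\<bar> / 2"
    using d(2)[of "(\<xi>, \<eta>)"] near[OF 1(1-4)] h by simp
  moreover have "dist (g21 \<xi>' \<eta>') (g21 a b) < \<bar>g12 a b - g21 a b\<bar> / 2"
    using d'(2)[of "(\<xi>', \<eta>')"] near[OF 2(3,4,1,2)] h by simp
  ultimately show False by (simp add: dist_real_def abs_if split: if_splits)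
qed

section \<open>Smooth functions of compact support\<close>

lemma continuous_on_fun_upd:
  fixes f :: "'a::topological_space \<Rightarrow> 'i \<Rightarrow> 'b::topological_space"
  assumes "continuous_on S f" "continuous_on S g"
  shows "continuous_on S (\<lambda>x. (f x)(i := g x))"
proof (rule continuous_on_coordinatewise_then_product)
  fix k
  have "continuous_on S (\<lambda>x. f x k)" using assms(1) by (rule continuous_on_product_then_coordinatewise)
  then show "continuous_on S (\<lambda>x. ((f x)(i := g x)) k)" using assms(2) by (cases "k = i") auto
qed

lemma fun_upd_in_Euclidean_space:
  "x \<in> topspace (Euclidean_space m) \<Longrightarrow> i < m \<Longrightarrow> x(i := t) \<in> topspace (Euclidean_space m)"
  by (auto simp: topspace_Euclidean_space)

lemma Cc_infinity_continuous_on: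
  assumes "\<phi> \<in> Cc_infinity m"
  shows "continuous_on (topspace (Euclidean_space m)) \<phi>"
proof -
  have "Ck m 0 \<phi>" using assms unfolding Cc_infinity_def by blast
  then show ?thesis by (simp add: continuous_map_Euclidean_space_iff)
qed

lemma Cc_infinity_has_derivative:
  assumes "\<phi> \<in> Cc_infinity m" "x \<in> topspace (Euclidean_space m)" "i < m"
  shows "((\<lambda>t. \<phi> (x(i := t))) has_real_derivative partial_deriv i \<phi> (x(i := t))) (at t)"
proof -
  have "Ck m (Suc 0) \<phi>" using assms(1) unfolding Cc_infinity_def by blast
  then have "(\<lambda>r. \<phi> ((x(i := t))(i := r))) differentiable at ((x(i := t)) i)"
    using fun_upd_in_Euclidean_space[OF assms(2,3)] assms(3) unfolding Ck.simps by blast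
  then have "(\<lambda>r. \<phi> (x(i := r))) field_differentiable at t"
    by (simp add: real_differentiable_def field_differentiable_def)
  then show ?thesis
    unfolding partial_deriv_def by (simp add: DERIV_deriv_iff_field_differentiable)
qed

text \<open>Off its closed support \<open>\<phi>\<close> vanishes on a short segment of every
  coordinate line, hence so does its derivative. The support of the derivative is therefore a closed
  subset of a compact set.\<close>

lemma partial_deriv_in_Cc_infinity:
  assumes \<phi>: "\<phi> \<in> Cc_infinity m" and i: "i < m"
  shows "partial_deriv i \<phi> \<in> Cc_infinity m"
proof -
  let ?E = "Euclidean_space m"
  let ?S = "?E closure_of {x \<in> topspace ?E. \<phi> x \<noteq> 0}"
  have "Ck m k (partial_deriv i \<phi>)" for k
  proof -
    have "Ck m (Suc k) \<phi>" using \<phi> unfolding Cc_infinity_def by blast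
    then show ?thesis using i unfolding Ck.simps by blast
  qed
  moreover have "{x \<in> topspace ?E. partial_deriv i \<phi> x \<noteq> 0} \<subseteq> ?S"
  proof (rule ccontr)
    assume "\<not> ?thesis"
    then obtain x where x: "x \<in> topspace ?E" "partial_deriv i \<phi> x \<noteq> 0" "x \<notin> ?S" by blast
    let ?U = "(\<lambda>t. x(i := t)) -` (- ?S)"
    have "closed ?S" by (rule closedin_Euclidean_imp_closed[OF closedin_closure_of])
    then have "open ?U"
      by (intro open_vimage) (auto intro: continuous_on_fun_upd continuous_intros)
    moreover have "\<phi> (x(i := t)) = 0" if "t \<in> ?U" for t
      using that closure_of_subset[of "{x \<in> topspace ?E. \<phi> x \<noteq> 0}" ?E] fun_upd_in_Euclidean_space[OF x(1) i, of t]
      by auto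
    moreover have "x i \<in> ?U" using x(3) by simp
    ultimately have "((\<lambda>t. \<phi> (x(i := t))) has_real_derivative 0) (at (x i))"
      by (intro has_field_derivative_transform_within_open[OF DERIV_const[of 0]]) auto
    then have "partial_deriv i \<phi> x = 0" unfolding partial_deriv_def by (rule DERIV_imp_deriv)
    then show False using x(2) by simp
  qed
  then have sub: "?E closure_of {x \<in> topspace ?E. partial_deriv i \<phi> x \<noteq> 0} \<subseteq> ?S"
    by (rule closure_of_minimal) simp
  have "compactin ?E ?S" using \<phi> unfolding Cc_infinity_def by blast
  then have "compactin ?E (?E closure_of {x \<in> topspace ?E. partial_deriv i \<phi> x \<noteq> 0})"
    using sub closedin_closure_of by (rule closed_compactin)
  ultimately show ?thesis unfolding Cc_infinity_def by blast
qed

text \<open>Supplies the derivatives in the directions on which a cylindrical function does not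
  depend.\<close>

lemma zero_in_Cc_infinity: "(\<lambda>_. 0) \<in> Cc_infinity m"
proof -
  have "partial_deriv i (\<lambda>_. 0) = (\<lambda>_. 0)" for i by (simp add: partial_deriv_def fun_eq_iff)
  then have "Ck m k (\<lambda>_. 0)" for k by (induction k) auto
  then show ?thesis by (simp add: Cc_infinity_def)
qed

text \<open>Applied with \<open>g\<close> constant to bound test functions, and with
  \<open>g\<close> a coordinate to absorb the linear factor that Gaussian integration by parts
  produces.\<close>

lemma Cc_infinity_mult_bounded:
  assumes \<phi>: "\<phi> \<in> Cc_infinity m" and g: "continuous_on (topspace (Euclidean_space m)) g"
  obtains B where "\<And>x. x \<in> topspace (Euclidean_space m) \<Longrightarrow> \<bar>g x * \<phi> x\<bar> \<le> B"
proof -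
  let ?E = "Euclidean_space m"
  let ?S = "?E closure_of {x \<in> topspace ?E. \<phi> x \<noteq> 0}"
  have "continuous_map ?E euclideanreal (\<lambda>x. g x * \<phi> x)"
    unfolding continuous_map_Euclidean_space_iff
    by (intro continuous_intros g Cc_infinity_continuous_on[OF \<phi>])
  then have "compact ((\<lambda>x. g x * \<phi> x) ` ?S)"
    using image_compactin[of ?E ?S] \<phi> by (simp add: Cc_infinity_def flip: compactin_euclidean_iff)
  then have "\<exists>B. \<forall>x\<in>?S. \<bar>g x * \<phi> x\<bar> \<le> B"
    by (auto dest!: compact_imp_bounded simp: bounded_iff)
  then obtain B where B: "\<forall>x\<in>?S. \<bar>g x * \<phi> x\<bar> \<le> B" ..
  \<comment> \<open>For empty support \<open>B\<close> is arbitrary and may be negative, hence the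
    maximum with 0.\<close>
  have "\<bar>g x * \<phi> x\<bar> \<le> max B 0" if "x \<in> topspace ?E" for x
  proof (cases "\<phi> x = 0")
    case False
    then have "x \<in> ?S" using that closure_of_subset[of "{x \<in> topspace ?E. \<phi> x \<noteq> 0}" ?E] by blast
    then show ?thesis using B by (simp add: le_max_iff_disj)
  qed simp
  then show thesis by (rule that)
qed

text \<open>Both derivatives only see the plane through \<open>x\<close> in the directions
  \<open>i\<close> and \<open>j\<close>, where the two-variable result applies.\<close>

lemma partial_deriv_commute:
  assumes \<phi>: "\<phi> \<in> Cc_infinity m" and x: "x \<in> topspace (Euclidean_space m)" and ij: "i < m" "j < m"
  shows "partial_deriv j (partial_deriv i \<phi>) x = partial_deriv i (partial_deriv j \<phi>) x"
proof (cases "i = j")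
  case False
  let ?y = "\<lambda>s t. x(i := s, j := t)"
  have y: "?y s t \<in> topspace (Euclidean_space m)" "x(j := t) \<in> topspace (Euclidean_space m)"
      "x(i := s) \<in> topspace (Euclidean_space m)" for s t
    using x ij by (simp_all add: fun_upd_in_Euclidean_space)
  note tw = fun_upd_twist[OF False]
  have 1: "((\<lambda>s. \<psi> (?y s t)) has_real_derivative partial_deriv i \<psi> (?y s t)) (at s)"
    if "\<psi> \<in> Cc_infinity m" for \<psi> s t
    using Cc_infinity_has_derivative[OF that y(2) ij(1)] unfolding tw .
  have 2: "((\<lambda>t. \<psi> (?y s t)) has_real_derivative partial_deriv j \<psi> (?y s t)) (at t)"
    if "\<psi> \<in> Cc_infinity m" for \<psi> s t
    using Cc_infinity_has_derivative[OF that y(3) ij(2)] .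
  have cont: "isCont (\<lambda>(s, t). \<psi> (?y s t)) p" if "\<psi> \<in> Cc_infinity m" for \<psi> p
  proof -
    have "continuous_on UNIV (\<lambda>p. ?y (fst p) (snd p))"
      by (intro continuous_on_fun_upd continuous_intros)
    then have "continuous_on UNIV (\<lambda>p. \<psi> (?y (fst p) (snd p)))"
      using y(1) by (intro continuous_on_compose2[OF Cc_infinity_continuous_on[OF that]]) auto
    then have "isCont (\<lambda>p. \<psi> (?y (fst p) (snd p))) p" by (metis UNIV_I continuous_on_eq_continuous_at open_UNIV)
    then show ?thesis by (simp only: case_prod_unfold)
  qed
  note D = partial_deriv_in_Cc_infinity
  have "partial_deriv j (partial_deriv i \<phi>) (?y (x i) (x j)) = partial_deriv i (partial_deriv j \<phi>) (?y (x i) (x j))"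
  proof (rule mixed_partial_derivatives_eq[where a = "x i" and b = "x j" and g = "\<lambda>s t. \<phi> (?y s t)"
        and ?g1.0 = "\<lambda>s t. partial_deriv i \<phi> (?y s t)" and ?g2.0 = "\<lambda>s t. partial_deriv j \<phi> (?y s t)"
        and ?g12.0 = "\<lambda>s t. partial_deriv j (partial_deriv i \<phi>) (?y s t)"
        and ?g21.0 = "\<lambda>s t. partial_deriv i (partial_deriv j \<phi>) (?y s t)"])
    show "((\<lambda>s. \<phi> (?y s t)) has_real_derivative partial_deriv i \<phi> (?y s t)) (at s)" for s t
      by (rule 1[OF \<phi>])
    show "((\<lambda>t. \<phi> (?y s t)) has_real_derivative partial_deriv j \<phi> (?y s t)) (at t)" for s t
      by (rule 2[OF \<phi>])
    show "((\<lambda>t. partial_deriv i \<phi> (?y s t)) has_real_derivative partial_deriv j (partial_deriv i \<phi>) (?y s t)) (at t)" for s t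
      by (rule 2[OF D[OF \<phi> ij(1)]])
    show "((\<lambda>s. partial_deriv j \<phi> (?y s t)) has_real_derivative partial_deriv i (partial_deriv j \<phi>) (?y s t)) (at s)" for s t
      by (rule 1[OF D[OF \<phi> ij(2)]])
    show "isCont (\<lambda>(s, t). partial_deriv j (partial_deriv i \<phi>) (?y s t)) (x i, x j)"
      by (rule cont[OF D[OF D[OF \<phi> ij(1)] ij(2)]])
    show "isCont (\<lambda>(s, t). partial_deriv i (partial_deriv j \<phi>) (?y s t)) (x i, x j)"
      by (rule cont[OF D[OF D[OF \<phi> ij(2)] ij(1)]])
  qed
  then show ?thesis by simp
qed simp

section \<open>The scale of Hilbert spaces in coordinates\<close>

instance separable_chilbert \<subseteq> banach ..

lemma cinner_scaleC_left: "cinner (a *\<^sub>C x) y = cnj a * cinner x (y :: 'a::complex_inner)"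
  by (metis cinner_commute cinner_scaleC_right complex_cnj_mult)

lemma cinner_scaleR_right: "cinner x (r *\<^sub>R y) = complex_of_real r * cinner x (y :: 'a::complex_inner)"
  by (simp add: scaleR_scaleC cinner_scaleC_right)

lemma scaleC_zero_left: "0 *\<^sub>C x = (0 :: 'a::complex_inner)"
  using scaleR_scaleC[of 0 x] by simp

lemma scaleC_one: "1 *\<^sub>C x = (x :: 'a::complex_inner)"
  using scaleR_scaleC[of 1 x] by simp

lemma scaleC_scaleR: "a *\<^sub>C (r *\<^sub>R x) = r *\<^sub>R (a *\<^sub>C (x :: 'a::complex_inner))"
  by (simp add: scaleR_scaleC scaleC_scaleC mult.commute)

lemma cinner_sum_right: "cinner x (sum f S) = (\<Sum>i\<in>S. cinner x (f i :: 'a::complex_inner))"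
proof -
  have "cinner x (0 :: 'a) = 0" using cinner_scaleC_right[of x 0 0] by (simp add: scaleC_zero_left)
  then show ?thesis
    by (induction S rule: infinite_finite_induct) (simp_all add: cinner_add_right)
qed

lemma orthogonal_components:
  fixes e :: "nat \<Rightarrow> 'a::complex_inner"
  assumes "\<And>j k. cinner (e j) (e k) = (if j = k then 1 else 0)"
  shows "inner (a *\<^sub>C e j) (b *\<^sub>C e k) = (if j = k then Re (cnj a * b) else 0)"
  by (simp add: inner_eq_Re_cinner cinner_scaleC_left cinner_scaleC_right assms)

lemma Bessel_inequality:
  fixes e :: "nat \<Rightarrow> 'a::complex_inner"
  assumes e: "\<And>j k. cinner (e j) (e k) = (if j = k then 1 else 0)"
  shows "(\<Sum>k<n. (cmod (cinner (e k) x))\<^sup>2) \<le> (norm x)\<^sup>2"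
proof -
  let ?y = "\<Sum>k<n. cinner (e k) x *\<^sub>C e k"
  have "inner x (cinner (e k) x *\<^sub>C e k) = (cmod (cinner (e k) x))\<^sup>2" for k
  proof -
    have "cinner x (cinner (e k) x *\<^sub>C e k) = cinner (e k) x * cnj (cinner (e k) x)"
      by (simp add: cinner_scaleC_right cinner_commute[of x])
    then show ?thesis by (simp add: inner_eq_Re_cinner complex_norm_square[symmetric] del: of_real_power)
  qed
  then have 1: "inner x ?y = (\<Sum>k<n. (cmod (cinner (e k) x))\<^sup>2)"
    by (simp add: inner_sum_right)
  have "inner (cinner (e j) x *\<^sub>C e j) ?y = (cmod (cinner (e j) x))\<^sup>2" if "j < n" for j
    using that unfolding cmod_power2 by (simp add: inner_sum_right orthogonal_components[OF e] power2_eq_square)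
  then have 2: "inner ?y ?y = (\<Sum>k<n. (cmod (cinner (e k) x))\<^sup>2)"
    by (subst inner_sum_left) simp
  have "0 \<le> inner (x - ?y) (x - ?y)" by simp
  also have "\<dots> = inner x x - 2 * inner x ?y + inner ?y ?y"
    by (simp add: inner_diff_left inner_diff_right inner_commute)
  finally show ?thesis using 1 2 by (simp add: power2_norm_eq_inner)
qed

text \<open>By Pythagoras the squared norm of a block of the series is the block of squared norms,
  so the Cauchy criterion carries over.\<close>

lemma summable_if_orthogonal:
  fixes f :: "nat \<Rightarrow> 'a::{real_inner, banach}"
  assumes orth: "\<And>i j. i \<noteq> j \<Longrightarrow> orthogonal (f i) (f j)" and sq: "summable (\<lambda>k. (norm (f k))\<^sup>2)"
  shows "summable f"
  unfolding summable_Cauchy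
proof (intro allI impI)
  fix \<epsilon> :: real assume "\<epsilon> > 0"
  then obtain N where N: "\<And>m n. m \<ge> N \<Longrightarrow> norm (\<Sum>k=m..<n. (norm (f k))\<^sup>2) < \<epsilon>\<^sup>2"
    using sq unfolding summable_Cauchy by (metis zero_less_power)
  have "norm (sum f {m..<n}) < \<epsilon>" if "m \<ge> N" for m n
  proof -
    have "(norm (sum f {m..<n}))\<^sup>2 = (\<Sum>k=m..<n. (norm (f k))\<^sup>2)"
      by (rule norm_sum_Pythagorean) (auto simp: pairwise_def orth)
    also have "\<dots> < \<epsilon>\<^sup>2" using N[OF that, of n] by (simp add: sum_nonneg)
    finally show ?thesis using \<open>\<epsilon> > 0\<close> power2_less_imp_less by fastforce
  qed
  then show "\<exists>N. \<forall>m\<ge>N. \<forall>n. norm (sum f {m..<n}) < \<epsilon>" by blast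
qed

text \<open>The real orthonormal basis: \<open>(j, False)\<close> is the index of \<open>e\<^sub>j\<close> and \<open>(j, True)\<close> that of \<open>f\<^sub>j\<close>.\<close>

definition real_basis :: "(nat \<Rightarrow> 'h::complex_inner) \<Rightarrow> nat \<times> bool \<Rightarrow> 'h" where
  "real_basis e p = (if snd p then \<i> else 1) *\<^sub>C e (fst p)"

text \<open>The duality pairing with a basis vector, written as an inner product of the completion.
  Two factors \<open>lam j powr (- s / 2)\<close> enter through the norm of the completion, and
  \<open>lam j powr s\<close> cancels them. In this form continuity and linearity on the whole
  completion are immediate.\<close>

definition coordinate ::
  "(nat \<Rightarrow> 'h::complex_inner) \<Rightarrow> (nat \<Rightarrow> real) \<Rightarrow> real \<Rightarrow> ('h \<Rightarrow> 'k::complex_inner) \<Rightarrow> nat \<times> bool \<Rightarrow> 'k \<Rightarrow> real"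
  where "coordinate e lam s \<iota> p u = lam (fst p) powr s * inner u (\<iota> (real_basis e p))"

section \<open>Pairing, coordinates and the inverse operator\<close>

locale eigenbasis_completion =
  fixes e :: "nat \<Rightarrow> 'h::separable_chilbert" and lam :: "nat \<Rightarrow> real" and c s :: real
    and \<iota> :: "'h \<Rightarrow> 'k::separable_chilbert"
  assumes basis: "orthonormal_basis e" and c: "c > 0" "\<And>j. c \<le> lam j" and s: "s \<ge> 0"
    and completion: "neg_sobolev_completion e lam s \<iota>"
begin

abbreviation "b \<equiv> real_basis e"
abbreviation "X \<equiv> coordinate e lam s \<iota>"

lemma lam_pos: "lam j > 0"
  using c(1) c(2)[of j] by simp

lemma cinner_e: "cinner (e j) (e k) = (if j = k then 1 else 0)"
  using basis by (simp add: orthonormal_basis_def)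

lemma b_False: "b (j, False) = e j" and b_True: "b (j, True) = \<i> *\<^sub>C e j"
  by (simp_all add: real_basis_def scaleC_one)

lemma inner_b: "inner (b p) (b q) = (if p = q then 1 else 0)"
  by (cases p; cases q) (auto simp: real_basis_def orthogonal_components[OF cinner_e])

lemma inner_b_sum: "finite I \<Longrightarrow> inner (b q) (\<Sum>p\<in>I. a p *\<^sub>R b p) = (if q \<in> I then a q else 0)"
  by (simp add: inner_sum_right inner_b if_distrib[of "(*) _"] cong: if_cong)

text \<open>A negative power is bounded: \<open>lam j\<close> is at least \<open>c\<close>, so the
  coefficients are at most \<open>c powr (- s / 2)\<close> and Bessel's inequality applies.
  Convergence is what allows inner products to be taken term by term.\<close>

lemma summable_Apow: "summable (\<lambda>j. lam j powr (- s / 2) *\<^sub>R (cinner (e j) x *\<^sub>C e j))" (is "summable ?f")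
proof (rule summable_if_orthogonal)
  show "orthogonal (?f i) (?f j)" if "i \<noteq> j" for i j
    using that by (simp add: orthogonal_def orthogonal_components[OF cinner_e])
  have norm: "(norm (z *\<^sub>C e j))\<^sup>2 = (cmod z)\<^sup>2" for z j
    unfolding cmod_power2 unfolding power2_norm_eq_inner by (simp add: orthogonal_components[OF cinner_e] power2_eq_square)
  have "summable (\<lambda>j. (cmod (cinner (e j) x))\<^sup>2)"
    by (rule summableI_nonneg_bounded[OF _ Bessel_inequality[OF cinner_e]]) simp
  then have "summable (\<lambda>j. (c powr (- s / 2))\<^sup>2 * (cmod (cinner (e j) x))\<^sup>2)"
    by (rule summable_mult)
  then show "summable (\<lambda>j. (norm (?f j))\<^sup>2)"
  proof (rule summable_comparison_test')
    fix j
    have "lam j powr (- s / 2) \<le> c powr (- s / 2)"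
      using c s by (intro powr_mono2') auto
    then show "norm ((norm (?f j))\<^sup>2) \<le> (c powr (- s / 2))\<^sup>2 * (cmod (cinner (e j) x))\<^sup>2"
      by (simp add: power_mult_distrib norm mult_right_mono power_mono)
  qed
qed

lemma inner_Apow_b: "inner (Apow e lam (- s / 2) x) (b p) = lam (fst p) powr (- s / 2) * inner x (b p)"
proof -
  have "inner (Apow e lam (- s / 2) x) (b p)
      = (\<Sum>j. inner (lam j powr (- s / 2) *\<^sub>R (cinner (e j) x *\<^sub>C e j)) (b p))"
    unfolding Apow_def by (rule bounded_linear.suminf[OF bounded_linear_inner_left summable_Apow])
  also have "\<dots> = (\<Sum>j\<in>{fst p}. inner (lam j powr (- s / 2) *\<^sub>R (cinner (e j) x *\<^sub>C e j)) (b p))"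
    by (rule suminf_finite) (auto simp: real_basis_def orthogonal_components[OF cinner_e])
  also have "\<dots> = lam (fst p) powr (- s / 2) * inner x (b p)"
    by (simp add: real_basis_def orthogonal_components[OF cinner_e] inner_eq_Re_cinner[of x]
        cinner_scaleC_right cinner_commute[of x])
  finally show ?thesis .
qed

lemma Apow_b: "Apow e lam (- s / 2) (b p) = lam (fst p) powr (- s / 2) *\<^sub>R b p"
proof -
  have "Apow e lam (- s / 2) (b p) = (\<Sum>j\<in>{fst p}. lam j powr (- s / 2) *\<^sub>R (cinner (e j) (b p) *\<^sub>C e j))"
    unfolding Apow_def by (rule suminf_finite) (auto simp: real_basis_def cinner_scaleC_right cinner_e scaleC_zero_left)
  then show ?thesis by (simp add: real_basis_def cinner_scaleC_right cinner_e)
qed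

lemma X_\<iota>: "X p (\<iota> x) = inner x (b p)"
proof -
  have "inner (\<iota> x) (\<iota> (b p)) = inner (Apow e lam (- s / 2) x) (Apow e lam (- s / 2) (b p))"
    using completion by (simp add: neg_sobolev_completion_def inner_eq_Re_cinner)
  then show ?thesis
    using lam_pos[of "fst p"] unfolding coordinate_def Apow_b inner_scaleR_right inner_Apow_b
    by (simp add: mult.assoc[symmetric] powr_add[symmetric])
qed

lemma bounded_linear_X: "bounded_linear (X p)"
  unfolding coordinate_def by (intro bounded_linear_const_mult bounded_linear_inner_left)

text \<open>The right-hand side is continuous and correct on the dense range of
  \<open>\<iota>\<close>, so it is the unique extension that \<open>pairing\<close> describes.
  Finite sums are treated at once because they are the test vectors in the characteristic function
  of the Gaussian measure.\<close>

lemma pairing_sum: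
  assumes "finite I"
  shows "pairing \<iota> u (\<Sum>p\<in>I. a p *\<^sub>R b p) = (\<Sum>p\<in>I. a p * X p u)"
proof -
  let ?w = "\<Sum>p\<in>I. a p *\<^sub>R b p" and ?g = "\<lambda>u. \<Sum>p\<in>I. a p * X p u"
  have "(THE g. continuous_on UNIV g \<and> (\<forall>x. g (\<iota> x) = inner x ?w)) = ?g"
  proof (rule the_equality)
    show g: "continuous_on UNIV ?g \<and> (\<forall>x. ?g (\<iota> x) = inner x ?w)"
      using linear_continuous_on[OF bounded_linear_X] by (auto intro!: continuous_intros simp: X_\<iota> inner_sum_right)
    fix g assume g': "continuous_on UNIV g \<and> (\<forall>x. g (\<iota> x) = inner x ?w)"
    have "continuous_on UNIV (\<lambda>u. g u - ?g u)"
      by (intro continuous_on_diff) (use g g' in blast)+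
    moreover have "g v - ?g v = 0" if "v \<in> range \<iota>" for v
      using that g g' by force
    moreover have "closure (range \<iota>) = UNIV"
      using completion by (simp add: neg_sobolev_completion_def)
    ultimately have "g v - ?g v = 0" for v
      using continuous_constant_on_closure[of "range \<iota>" "\<lambda>u. g u - ?g u" 0 v] by (metis UNIV_I)
    then show "g = ?g" by (simp add: fun_eq_iff)
  qed
  then show ?thesis by (simp add: pairing_def)
qed

lemma pairing_b: "pairing \<iota> u (b p) = X p u"
  using pairing_sum[of "{p}" u "\<lambda>_. 1"] by simp

lemma pairing_e: "pairing \<iota> u (e j) = X (j, False) u"
  and pairing_f: "pairing \<iota> u (\<i> *\<^sub>C e j) = X (j, True) u"
  by (simp_all add: b_False b_True flip: pairing_b)

lemma in_sobolev:
  assumes "finite I"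
  shows "(\<Sum>p\<in>I. a p *\<^sub>R b p) \<in> sobolev e lam s"
proof -
  let ?w = "\<Sum>p\<in>I. a p *\<^sub>R b p"
  have "cinner (e j) ?w = 0" if "j \<notin> fst ` I" for j
  proof -
    have "cinner (e j) (b p) = 0" if "p \<in> I" for p
      using that \<open>j \<notin> fst ` I\<close> by (auto simp: real_basis_def cinner_scaleC_right cinner_e)
    then show ?thesis by (simp add: cinner_sum_right cinner_scaleR_right)
  qed
  then have "summable (\<lambda>j. (lam j powr (s / 2) * cmod (cinner (e j) ?w))\<^sup>2)"
    using assms by (intro summable_finite[of "fst ` I"]) auto
  then show ?thesis by (simp add: sobolev_def Apow_dom_def)
qed

lemma b_in_sobolev: "b p \<in> sobolev e lam s"
  using in_sobolev[of "{p}" "\<lambda>_. 1"] by simp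

text \<open>A preimage of \<open>w\<close> is obtained by dividing its coefficients by the
  eigenvalues, and the lower bound makes \<open>A\<close> injective on \<open>D\<close>, so
  \<open>inv_into\<close> selects this preimage.\<close>

lemma cinner_inv_into:
  fixes a :: "nat \<times> bool \<Rightarrow> real"
  assumes self_adjoint: "self_adjoint D A" and bounded_below: "bounded_below D A c"
    and eigen: "\<And>j. e j \<in> D \<and> A (e j) = lam j *\<^sub>R e j" and I: "finite I"
  defines "w \<equiv> (\<Sum>p\<in>I. a p *\<^sub>R b p)"
  shows "cinner w (inv_into D A w) = complex_of_real (\<Sum>p\<in>I. (a p)\<^sup>2 / lam (fst p))"
proof -
  have lin: "0 \<in> D" "\<And>x y. x \<in> D \<Longrightarrow> y \<in> D \<Longrightarrow> x + y \<in> D \<and> A (x + y) = A x + A y"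
    "\<And>x a. x \<in> D \<Longrightarrow> a *\<^sub>C x \<in> D \<and> A (a *\<^sub>C x) = a *\<^sub>C A x"
    using self_adjoint by (auto simp: self_adjoint_def clinear_on_def)
  have linR: "\<And>x r. x \<in> D \<Longrightarrow> r *\<^sub>R x \<in> D \<and> A (r *\<^sub>R x) = r *\<^sub>R A x"
    using lin(3) by (simp add: scaleR_scaleC)
  have A0: "A 0 = 0" using linR[OF lin(1), of 0] by simp
  have A_b: "b p \<in> D \<and> A (b p) = lam (fst p) *\<^sub>R b p" for p
    using lin(3) eigen by (simp add: real_basis_def scaleC_scaleR)
  define v where "v = (\<Sum>p\<in>I. (a p / lam (fst p)) *\<^sub>R b p)"
  have A_sum: "(\<Sum>p\<in>J. r p *\<^sub>R b p) \<in> D \<and> A (\<Sum>p\<in>J. r p *\<^sub>R b p) = (\<Sum>p\<in>J. (r p * lam (fst p)) *\<^sub>R b p)"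
    if "finite J" for J and r :: "nat \<times> bool \<Rightarrow> real"
    using that by (induction J) (simp_all add: lin A0 linR A_b)
  have v: "v \<in> D" "A v = w"
    using A_sum[OF I, of "\<lambda>p. a p / lam (fst p)"] lam_pos less_imp_neq[OF lam_pos] by (auto simp: v_def w_def)
  have "inj_on A D"
  proof (rule inj_onI)
    fix x y assume xy: "x \<in> D" "y \<in> D" "A x = A y"
    then have "x - y \<in> D \<and> A (x - y) = A x - A y"
      using lin(2)[of x "(-1) *\<^sub>R y"] linR[of y "-1"] by simp
    then have "c * inner (x - y) (x - y) \<le> 0"
      using bounded_below xy(3) by (auto simp: bounded_below_def)
    then have "inner (x - y) (x - y) \<le> 0" using c(1) by (simp add: mult_le_0_iff)
    then show "x = y" by (metis antisym eq_iff_diff_eq_0 inner_eq_zero_iff inner_ge_zero)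
  qed
  then have inv: "inv_into D A w = v" using v inv_into_f_f by metis
  \<comment> \<open>The real basis is orthogonal only for the real inner product:
    \<open>cinner (e j) (\<i> *\<^sub>C e j)\<close> is \<open>\<i>\<close>. Expansion therefore
    yields just the real part, and symmetry of \<open>A\<close> removes the imaginary one.\<close>
  have "cinner v (A v) = cinner (A v) v"
    using self_adjoint v(1) unfolding self_adjoint_def by blast
  then have "cnj (cinner w v) = cinner w v"
    using v(2) cinner_commute[of v w] by simp
  then have "cinner w v = complex_of_real (Re (cinner w v))"
    by (simp add: complex_eq_iff)
  moreover have "Re (cinner w v) = (\<Sum>p\<in>I. (a p)\<^sup>2 / lam (fst p))"
    unfolding inner_eq_Re_cinner[symmetric] w_def inner_sum_left
    by (simp add: v_def inner_b_sum I power2_eq_square cong: sum.cong)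
  ultimately show ?thesis by (simp add: inv)
qed

end

section \<open>Cylindrical functions\<close>

lemma suminf_eq_sum_lessThan:
  fixes g :: "nat \<Rightarrow> 'a::real_normed_vector"
  assumes "\<And>j. n \<le> j \<Longrightarrow> g j = 0"
  shows "suminf g = (\<Sum>j<n. g j)"
  by (rule suminf_finite) (use assms in auto)

context eigenbasis_completion
begin

definition pd :: "nat \<times> bool \<Rightarrow> ('k \<Rightarrow> real) \<Rightarrow> 'k \<Rightarrow> real" where
  "pd p = dir_deriv (\<iota> (b p))"

lemma de_eq: "de \<iota> e j = pd (j, False)" and df_eq: "df \<iota> e j = pd (j, True)"
  by (simp_all add: de_def df_def pd_def b_False b_True)

lemma X_b: "X p (\<iota> (b q)) = (if p = q then 1 else 0)"
  by (simp add: X_\<iota> inner_b)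

lemma X_add: "X p (u + v) = X p u + X p v" and X_scaleR: "X p (r *\<^sub>R u) = r * X p u"
  and X_sum: "X p (sum g S) = (\<Sum>j\<in>S. X p (g j))"
  using bounded_linear.linear[OF bounded_linear_X, of p] by (auto simp: linear_add linear_scale linear_sum)

lemma X_line: "X p (u + t *\<^sub>R \<iota> (b q)) = (if p = q then X p u + t else X p u)"
  by (simp add: X_add X_scaleR X_b)

text \<open>The slot of a basis index in \<open>cyl_proj\<close>. It is meaningful for
  \<open>fst p < n\<close>; beyond that the two blocks overlap.\<close>

abbreviation position :: "nat \<Rightarrow> nat \<times> bool \<Rightarrow> nat" where
  "position n p \<equiv> (if snd p then n + fst p else fst p)"

lemma cyl_proj_eq:
  "cyl_proj \<iota> e n u = (\<lambda>i. if i < n then X (i, False) u else if i < 2 * n then X (i - n, True) u else 0)"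
  by (simp add: cyl_proj_def fun_eq_iff pairing_e pairing_f)

lemma cyl_proj_in_Euclidean_space: "cyl_proj \<iota> e n u \<in> topspace (Euclidean_space (2 * n))"
  by (simp add: topspace_Euclidean_space cyl_proj_eq)

lemma cyl_proj_position: "fst p < n \<Longrightarrow> cyl_proj \<iota> e n u (position n p) = X p u"
  by (cases p) (auto simp: cyl_proj_eq)

lemma continuous_cyl_proj: "continuous_on S (cyl_proj \<iota> e n)"
proof (rule continuous_on_coordinatewise_then_product)
  show "continuous_on S (\<lambda>u. cyl_proj \<iota> e n u i)" for i
    unfolding cyl_proj_eq using linear_continuous_on[OF bounded_linear_X]
    by (cases "i < n"; cases "i < 2 * n") simp_all
qed

lemma cyl_proj_line:
  "cyl_proj \<iota> e n (u + t *\<^sub>R \<iota> (b p)) =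
    (if fst p < n then (cyl_proj \<iota> e n u)(position n p := X p u + t) else cyl_proj \<iota> e n u)"
  by (cases p) (auto simp: cyl_proj_eq X_line fun_eq_iff)

text \<open>A line along a basis vector moves the projected point along one coordinate axis, or not
  at all. The second claim is separate because \<open>deriv\<close> has a value even where no
  derivative exists.\<close>

lemma pd_cylinder:
  assumes "\<phi> \<in> Cc_infinity (2 * n)"
  shows "pd p (\<phi> \<circ> cyl_proj \<iota> e n) =
    (if fst p < n then partial_deriv (position n p) \<phi> \<circ> cyl_proj \<iota> e n else (\<lambda>_. 0))"
    and "((\<lambda>t. (\<phi> \<circ> cyl_proj \<iota> e n) (u + t *\<^sub>R \<iota> (b p))) has_real_derivative pd p (\<phi> \<circ> cyl_proj \<iota> e n) u) (at 0)"
proof -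
  define D where "D = (if fst p < n then partial_deriv (position n p) \<phi> \<circ> cyl_proj \<iota> e n else (\<lambda>_. 0))"
  have D: "((\<lambda>t. (\<phi> \<circ> cyl_proj \<iota> e n) (u + t *\<^sub>R \<iota> (b p))) has_real_derivative D u) (at 0)" for u
  proof (cases "fst p < n")
    case True
    then have pos: "position n p < 2 * n" by simp
    let ?x = "cyl_proj \<iota> e n u"
    have "((\<lambda>r. \<phi> (?x(position n p := r))) has_real_derivative partial_deriv (position n p) \<phi> (?x(position n p := X p u))) (at (0 + X p u))"
      using Cc_infinity_has_derivative[OF assms cyl_proj_in_Euclidean_space pos] by simp
    then have "((\<lambda>t. \<phi> (?x(position n p := t + X p u))) has_real_derivative D u) (at 0)"
      using True unfolding DERIV_shift cyl_proj_position[OF True, symmetric] by (simp add: D_def)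
    then show ?thesis using True unfolding comp_def cyl_proj_line by (simp add: add.commute)
  next
    case False
    then show ?thesis by (simp add: D_def cyl_proj_line)
  qed
  then have eq: "pd p (\<phi> \<circ> cyl_proj \<iota> e n) = D"
    by (auto simp: pd_def dir_deriv_def fun_eq_iff intro: DERIV_imp_deriv)
  then show "pd p (\<phi> \<circ> cyl_proj \<iota> e n) =
    (if fst p < n then partial_deriv (position n p) \<phi> \<circ> cyl_proj \<iota> e n else (\<lambda>_. 0))"
    by (simp add: D_def)
  show "((\<lambda>t. (\<phi> \<circ> cyl_proj \<iota> e n) (u + t *\<^sub>R \<iota> (b p))) has_real_derivative pd p (\<phi> \<circ> cyl_proj \<iota> e n) u) (at 0)"
    unfolding eq by (rule D)
qed

lemma Cc_cylI: "\<phi> \<in> Cc_infinity (2 * n) \<Longrightarrow> \<phi> \<circ> cyl_proj \<iota> e n \<in> Cc_cyl \<iota> e"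
  unfolding Cc_cyl_def by blast

lemma zero_in_Cc_cyl: "(\<lambda>_. 0) \<in> Cc_cyl \<iota> e"
  using Cc_cylI[OF zero_in_Cc_infinity[of "2 * 0"]] by (simp add: comp_def)

lemma pd_in_Cc_cyl:
  assumes "F \<in> Cc_cyl \<iota> e"
  shows "pd p F \<in> Cc_cyl \<iota> e"
proof -
  obtain n \<phi> where \<phi>: "\<phi> \<in> Cc_infinity (2 * n)" and F: "F = \<phi> \<circ> cyl_proj \<iota> e n"
    using assms by (auto simp: Cc_cyl_def)
  show ?thesis
  proof (cases "fst p < n")
    case True
    then have "partial_deriv (position n p) \<phi> \<in> Cc_infinity (2 * n)"
      by (intro partial_deriv_in_Cc_infinity \<phi>) simp
    then show ?thesis
      unfolding F pd_cylinder(1)[OF \<phi>] using True by (simp only: if_True Cc_cylI)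
  next
    case False
    then show ?thesis
      unfolding F pd_cylinder(1)[OF \<phi>] using zero_in_Cc_cyl by simp
  qed
qed

lemma pd_commute:
  assumes "F \<in> Cc_cyl \<iota> e"
  shows "pd p (pd q F) = pd q (pd p F)"
proof -
  obtain n \<phi> where \<phi>: "\<phi> \<in> Cc_infinity (2 * n)" and F: "F = \<phi> \<circ> cyl_proj \<iota> e n"
    using assms by (auto simp: Cc_cyl_def)
  have zero: "pd r (\<lambda>_. 0) = (\<lambda>_. 0)" for r by (simp add: pd_def dir_deriv_def fun_eq_iff)
  let ?D = "\<lambda>r. partial_deriv (position n r) \<phi>"
  have pd_F: "pd r F = (if fst r < n then ?D r \<circ> cyl_proj \<iota> e n else (\<lambda>_. 0))" for r
    unfolding F by (rule pd_cylinder(1)[OF \<phi>])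
  have D: "?D r \<in> Cc_infinity (2 * n)" if "fst r < n" for r
    by (rule partial_deriv_in_Cc_infinity[OF \<phi>]) (use that in simp)
  have pd_D: "pd q (?D r \<circ> cyl_proj \<iota> e n)
      = (if fst q < n then partial_deriv (position n q) (?D r) \<circ> cyl_proj \<iota> e n else (\<lambda>_. 0))"
    if "fst r < n" for q r
    by (rule pd_cylinder(1)[OF D[OF that]])
  show ?thesis
  proof (cases "fst p < n \<and> fst q < n")
    case True
    then have pq: "position n p < 2 * n" "position n q < 2 * n" by simp_all
    have "partial_deriv (position n p) (?D q) \<circ> cyl_proj \<iota> e n
        = partial_deriv (position n q) (?D p) \<circ> cyl_proj \<iota> e n"
      unfolding comp_def by (rule ext) (rule partial_deriv_commute[OF \<phi> cyl_proj_in_Euclidean_space pq(2) pq(1)])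
    then show ?thesis using True by (simp only: pd_F pd_D if_True)
  next
    case False
    then show ?thesis by (cases "fst p < n"; cases "fst q < n") (simp_all only: pd_F pd_D zero if_True if_False simp_thms)
  qed
qed

text \<open>Turns the series in the gradient, the bracket and the two terms of the vector field into
  finite sums.\<close>

lemma eventually_pd_zero:
  assumes "F \<in> Cc_cyl \<iota> e"
  shows "\<exists>n. \<forall>j t u. n \<le> j \<longrightarrow> pd (j, t) F u = 0"
proof -
  obtain n \<phi> where \<phi>: "\<phi> \<in> Cc_infinity (2 * n)" and F: "F = \<phi> \<circ> cyl_proj \<iota> e n"
    using assms by (auto simp: Cc_cyl_def)
  have "\<forall>j t u. n \<le> j \<longrightarrow> pd (j, t) F u = 0" by (simp add: F pd_cylinder(1)[OF \<phi>])
  then show ?thesis ..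
qed

lemma continuous_Cc_cyl:
  assumes "F \<in> Cc_cyl \<iota> e"
  shows "continuous_on UNIV F"
proof -
  obtain n \<phi> where \<phi>: "\<phi> \<in> Cc_infinity (2 * n)" and F: "F = \<phi> \<circ> cyl_proj \<iota> e n"
    using assms by (auto simp: Cc_cyl_def)
  show ?thesis
    unfolding F comp_def
    by (rule continuous_on_compose2[OF Cc_infinity_continuous_on[OF \<phi>] continuous_cyl_proj])
      (use cyl_proj_in_Euclidean_space in blast)
qed

lemma bounded_Cc_cyl:
  assumes "F \<in> Cc_cyl \<iota> e"
  shows "bounded (range F)"
proof -
  obtain n \<phi> where \<phi>: "\<phi> \<in> Cc_infinity (2 * n)" and F: "F = \<phi> \<circ> cyl_proj \<iota> e n"
    using assms by (auto simp: Cc_cyl_def)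
  obtain B where "\<And>x. x \<in> topspace (Euclidean_space (2 * n)) \<Longrightarrow> \<bar>1 * \<phi> x\<bar> \<le> B"
    using Cc_infinity_mult_bounded[OF \<phi> continuous_on_const[of _ 1]] by blast
  then show ?thesis using cyl_proj_in_Euclidean_space by (auto simp: F bounded_iff)
qed

text \<open>If the derivative is not trivially zero, the common index of \<open>p\<close> and
  \<open>q\<close> is below \<open>n\<close>; then \<open>X q\<close> is one of the variables of the
  compactly supported profile of \<open>pd p F\<close>.\<close>

lemma bounded_X_pd:
  assumes "F \<in> Cc_cyl \<iota> e" and "fst q = fst p"
  shows "bounded (range (\<lambda>u. X q u * pd p F u))"
proof -
  obtain n \<phi> where \<phi>: "\<phi> \<in> Cc_infinity (2 * n)" and F: "F = \<phi> \<circ> cyl_proj \<iota> e n"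
    using assms by (auto simp: Cc_cyl_def)
  show ?thesis
  proof (cases "fst p < n")
    case True
    have cont: "continuous_on (topspace (Euclidean_space (2 * n))) (\<lambda>x. x (position n q))"
      by (rule continuous_on_product_then_coordinatewise[OF continuous_on_id])
    have "partial_deriv (position n p) \<phi> \<in> Cc_infinity (2 * n)"
      using True by (intro partial_deriv_in_Cc_infinity \<phi>) simp
    from Cc_infinity_mult_bounded[OF this cont]
    obtain B where "\<And>x. x \<in> topspace (Euclidean_space (2 * n)) \<Longrightarrow>
        \<bar>x (position n q) * partial_deriv (position n p) \<phi> x\<bar> \<le> B" by blast
    moreover have "X q u * pd p F u = cyl_proj \<iota> e n u (position n q) * partial_deriv (position n p) \<phi> (cyl_proj \<iota> e n u)" for u
    proof -
      have "pd p F u = partial_deriv (position n p) \<phi> (cyl_proj \<iota> e n u)"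
        unfolding F pd_cylinder(1)[OF \<phi>] by (simp only: True if_True comp_def)
      then show ?thesis using cyl_proj_position[of q n u] True assms(2) by (simp only:)
    qed
    ultimately have "\<bar>X q u * pd p F u\<bar> \<le> B" for u
      using cyl_proj_in_Euclidean_space by (simp only:)
    then show ?thesis by (auto simp: bounded_iff)
  next
    case False
    then show ?thesis by (simp add: F pd_cylinder(1)[OF \<phi>])
  qed
qed

text \<open>Translates convergence of gradients in the completion into convergence of each
  directional derivative.\<close>

lemma X_cyl_grad:
  assumes F: "F \<in> Cc_cyl \<iota> e"
  shows "X p (cyl_grad \<iota> e F u) = pd p F u"
proof -
  obtain n where n: "\<forall>j t u. n \<le> j \<longrightarrow> pd (j, t) F u = 0"
    using eventually_pd_zero[OF F] ..
  have "cyl_grad \<iota> e F u = (\<Sum>j<n. pd (j, False) F u *\<^sub>R \<iota> (b (j, False)) + pd (j, True) F u *\<^sub>R \<iota> (b (j, True)))"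
    unfolding cyl_grad_def de_eq df_eq b_False b_True
    by (rule suminf_eq_sum_lessThan) (simp add: n)
  then have "X p (cyl_grad \<iota> e F u) = (\<Sum>j<n. pd (j, False) F u * (if p = (j, False) then 1 else 0)
      + pd (j, True) F u * (if p = (j, True) then 1 else 0))"
    by (simp only: X_add X_scaleR X_sum X_b)
  also have "\<dots> = (\<Sum>j<n. if fst p = j then pd p F u else 0)"
  proof (rule sum.cong)
    show "pd (j, False) F u * (if p = (j, False) then 1 else 0) + pd (j, True) F u * (if p = (j, True) then 1 else 0)
        = (if fst p = j then pd p F u else 0)" for j
      by (cases p; cases "snd p") auto
  qed simp
  also have "\<dots> = pd p F u"
    using n[rule_format, of "fst p" "snd p" u] by (auto simp: not_less)
  finally show ?thesis .
qed

text \<open>Finite combinations of basis vectors lie in the Sobolev space, and on them the quadratic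
  form of the inverse operator is diagonal, with entries \<open>1 / lam j\<close>.\<close>

lemma gaussian_measure_coordinates:
  assumes self_adjoint: "self_adjoint D A" and bounded_below: "bounded_below D A c"
    and eigen: "\<And>j. e j \<in> D \<and> A (e j) = lam j *\<^sub>R e j" and "\<beta> > 0"
    and \<mu>: "gaussian_measure D A e lam s \<iota> \<beta> \<mu>"
  shows "gaussian_coordinates \<mu> X (\<lambda>p. \<iota> (b p)) (\<lambda>p. \<beta> * lam (fst p))"
proof -
  show ?thesis
  proof (intro gaussian_coordinates.intro gaussian_coordinates_axioms.intro)
    show "prob_space \<mu>" "sets \<mu> = sets borel" using \<mu> by (simp_all add: gaussian_measure_def)
    fix I :: "(nat \<times> bool) set" and a :: "nat \<times> bool \<Rightarrow> real"
    assume I: "finite I"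
    let ?w = "\<Sum>p\<in>I. a p *\<^sub>R b p"
    have "(\<integral>u. iexp (\<Sum>p\<in>I. a p * X p u) \<partial>\<mu>) = (\<integral>u. exp (\<i> * complex_of_real (pairing \<iota> u ?w)) \<partial>\<mu>)"
      by (simp only: pairing_sum[OF I])
    also have "\<dots> = exp (- (1 / (2 * complex_of_real \<beta>)) * cinner ?w (inv_into D A ?w))"
      using \<mu> in_sobolev[OF I] by (simp add: gaussian_measure_def)
    also have "\<dots> = complex_of_real (exp (- (1 / (2 * \<beta>)) * (\<Sum>p\<in>I. (a p)\<^sup>2 / lam (fst p))))"
      unfolding cinner_inv_into[OF self_adjoint bounded_below eigen I] by (simp flip: exp_of_real)
    also have "- (1 / (2 * \<beta>)) * (\<Sum>p\<in>I. (a p)\<^sup>2 / lam (fst p)) = - (\<Sum>p\<in>I. (a p)\<^sup>2 / (\<beta> * lam (fst p))) / 2"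
      by (simp add: sum_divide_distrib sum_distrib_left sum_negf field_simps)
    finally show "(\<integral>u. iexp (\<Sum>p\<in>I. a p * X p u) \<partial>\<mu>)
        = complex_of_real (exp (- (\<Sum>p\<in>I. (a p)\<^sup>2 / (\<beta> * lam (fst p))) / 2))" .
  qed (use \<open>\<beta> > 0\<close> lam_pos in \<open>simp_all add: bounded_linear_X X_b\<close>)
qed

end

section \<open>The Gibbs measure\<close>

lemma Lp_tendsto_2D:
  assumes "Lp_tendsto 2 M fs f"
  shows "\<And>n. fs n \<in> borel_measurable M" and "f \<in> borel_measurable M"
    and "integrable M (\<lambda>x. (norm (f x))\<^sup>2)" and "\<And>n. integrable M (\<lambda>x. (norm (fs n x))\<^sup>2)"
    and "\<And>n. integrable M (\<lambda>x. (norm (fs n x - f x))\<^sup>2)"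
    and "(\<lambda>n. \<integral>x. (norm (fs n x - f x))\<^sup>2 \<partial>M) \<longlonglongrightarrow> 0"
proof -
  show [measurable]: "fs n \<in> borel_measurable M" "f \<in> borel_measurable M" for n
    using assms by (auto simp: Lp_tendsto_def in_Lp_def)
  show f: "integrable M (\<lambda>x. (norm (f x))\<^sup>2)" and fs: "integrable M (\<lambda>x. (norm (fs n x))\<^sup>2)" for n
    using assms by (auto simp: Lp_tendsto_def in_Lp_def)
  show "(\<lambda>n. \<integral>x. (norm (fs n x - f x))\<^sup>2 \<partial>M) \<longlonglongrightarrow> 0"
    using assms by (simp add: Lp_tendsto_def)
  fix n
  show "integrable M (\<lambda>x. (norm (fs n x - f x))\<^sup>2)"
  proof (rule Bochner_Integration.integrable_bound)
    show "integrable M (\<lambda>x. 2 * (norm (fs n x))\<^sup>2 + 2 * (norm (f x))\<^sup>2)"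
      using f fs by simp
    have "(norm (fs n x - f x))\<^sup>2 \<le> 2 * (norm (fs n x))\<^sup>2 + 2 * (norm (f x))\<^sup>2" for x
    proof -
      have "(norm (fs n x - f x))\<^sup>2 \<le> (norm (fs n x) + norm (f x))\<^sup>2"
        by (intro power_mono norm_triangle_ineq4) simp
      also have "\<dots> \<le> 2 * (norm (fs n x))\<^sup>2 + 2 * (norm (f x))\<^sup>2"
        using sum_squares_bound[of "norm (fs n x)" "norm (f x)"] by (simp add: power2_sum)
      finally show ?thesis .
    qed
    then show "AE x in M. norm ((norm (fs n x - f x))\<^sup>2) \<le> norm (2 * (norm (fs n x))\<^sup>2 + 2 * (norm (f x))\<^sup>2)"
      by (simp add: order_trans[OF _ abs_ge_self])
  qed simp
qed

section \<open>Coordinatewise convergence and the KMS identity\<close>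

context eigenbasis_completion
begin

text \<open>Each coordinate is a bounded functional on the completion, so its square is at most a
  constant times the squared norm; the constant may depend on \<open>p\<close>.\<close>

lemma Lp_tendsto_2_X:
  assumes "Lp_tendsto 2 M fs f"
  shows "integrable M (\<lambda>u. (X p (f u))\<^sup>2)"
    and "\<And>n. integrable M (\<lambda>u. (X p (fs n u) - X p (f u))\<^sup>2)"
    and "(\<lambda>n. \<integral>u. (X p (fs n u) - X p (f u))\<^sup>2 \<partial>M) \<longlonglongrightarrow> 0"
proof -
  note L = Lp_tendsto_2D[OF assms]
  have [measurable]: "fs n \<in> borel_measurable M" "f \<in> borel_measurable M" for n by (rule L)+
  have [measurable]: "X p \<in> borel_measurable borel"
    by (intro borel_measurable_continuous_onI linear_continuous_on bounded_linear_X)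
  obtain K where K: "\<And>v. norm (X p v) \<le> norm v * K"
    using bounded_linear.bounded[OF bounded_linear_X] by blast
  have sq: "(X p v)\<^sup>2 \<le> K\<^sup>2 * (norm v)\<^sup>2" for v
  proof -
    have "(norm (X p v))\<^sup>2 \<le> (norm v * K)\<^sup>2" by (rule power_mono[OF K]) simp
    then show ?thesis by (simp add: power_mult_distrib mult.commute)
  qed
  have diff: "X p v - X p w = X p (v - w)" for v w
    using bounded_linear.linear[OF bounded_linear_X, of p] by (simp add: linear_diff)
  show "integrable M (\<lambda>u. (X p (f u))\<^sup>2)"
    by (rule Bochner_Integration.integrable_bound[OF integrable_mult_right[OF L(3), of "K\<^sup>2"]]) (use sq in auto)
  show int: "integrable M (\<lambda>u. (X p (fs n u) - X p (f u))\<^sup>2)" for n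
    unfolding diff
    by (rule Bochner_Integration.integrable_bound[OF integrable_mult_right[OF L(5)[of n], of "K\<^sup>2"]]) (use sq in auto)
  show "(\<lambda>n. \<integral>u. (X p (fs n u) - X p (f u))\<^sup>2 \<partial>M) \<longlonglongrightarrow> 0"
  proof (rule Lim_null_comparison)
    show "(\<lambda>n. K\<^sup>2 * (\<integral>u. (norm (fs n u - f u))\<^sup>2 \<partial>M)) \<longlonglongrightarrow> 0"
      using tendsto_mult_left[OF L(6), of "K\<^sup>2"] by simp
    have "(\<integral>u. (X p (fs n u) - X p (f u))\<^sup>2 \<partial>M) \<le> (\<integral>u. K\<^sup>2 * (norm (fs n u - f u))\<^sup>2 \<partial>M)" for n
      by (intro integral_mono int integrable_mult_right L) (simp add: diff sq)
    then show "\<forall>\<^sub>F n in sequentially. norm (\<integral>u. (X p (fs n u) - X p (f u))\<^sup>2 \<partial>M)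
        \<le> K\<^sup>2 * (\<integral>u. (norm (fs n u - f u))\<^sup>2 \<partial>M)"
      by simp
  qed
qed

lemma gibbs_measure_KMS:
  fixes h :: "'k \<Rightarrow> real"
  assumes self_adjoint: "self_adjoint D A" and bounded_below: "bounded_below D A c"
    and eigen: "\<And>j. e j \<in> D \<and> A (e j) = lam j *\<^sub>R e j" and "\<beta> > 0"
    and \<mu>: "gaussian_measure D A e lam s \<iota> \<beta> \<mu>"
    and h_meas [measurable]: "h \<in> borel_measurable borel"
    and int_exp: "integrable \<mu> (\<lambda>u. exp (- \<beta> * h u))"
    and Dh: "malliavin_deriv \<iota> e 2 \<mu> h Dh"
    and int_Dh: "\<And>w. w \<in> sobolev e lam s \<Longrightarrow> integrable \<mu> (\<lambda>u. pairing \<iota> (Dh u) w * exp (- \<beta> * h u))"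
  shows "KMS_state \<iota> e lam \<beta> Dh (gibbs_measure \<beta> h \<mu>)"
proof -
  interpret G: gaussian_coordinates \<mu> X "\<lambda>p. \<iota> (b p)" "\<lambda>p. \<beta> * lam (fst p)"
    by (rule gaussian_measure_coordinates[OF self_adjoint bounded_below eigen \<open>\<beta> > 0\<close> \<mu>])
  note [measurable_cong] = G.sets_M
  note [measurable] = G.measurable_X
  define Z where "Z = (\<integral>u. exp (- \<beta> * h u) \<partial>\<mu>)"
  have Z: "Z > 0"
  proof -
    have "Z \<noteq> 0"
    proof
      assume "Z = 0"
      then have "AE u in \<mu>. exp (- \<beta> * h u) = 0"
        using integral_nonneg_eq_0_iff_AE[OF int_exp] by (simp add: Z_def)
      then show False using G.AE_False by simp
    qed
    moreover have "Z \<ge> 0" unfolding Z_def by simp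
    ultimately show ?thesis by simp
  qed
  define g where "g u = exp (- \<beta> * h u) / Z" for u
  have [measurable]: "g \<in> borel_measurable borel" unfolding g_def by measurable
  have g0: "g u \<ge> 0" for u using Z by (simp add: g_def)
  have gibbs: "gibbs_measure \<beta> h \<mu> = density \<mu> (\<lambda>u. ennreal (g u))"
    by (simp add: gibbs_measure_def g_def Z_def)
  have Dh_meas [measurable]: "Dh \<in> borel_measurable \<mu>"
    using Dh by (auto simp: malliavin_deriv_def Lp_tendsto_def in_Lp_def)
  have Dh_borel [measurable]: "(\<lambda>u. X p (Dh u)) \<in> borel_measurable borel" for p
    using measurable_compose[OF Dh_meas G.measurable_X] by measurable
  have int_X_Dh: "integrable \<mu> (\<lambda>u. X p (Dh u) * exp (- \<beta> * h u))" for p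
    using int_Dh[OF b_in_sobolev] by (simp add: pairing_b)
  \<comment> \<open>Both sides of the KMS identity carry the same factor \<open>1 / Z\<close>, so it
    remains to compare weighted integrals against the Gaussian measure.\<close>
  have integrable_gibbs: "integrable (gibbs_measure \<beta> h \<mu>) f \<longleftrightarrow> integrable \<mu> (\<lambda>u. f u * exp (- \<beta> * h u))"
    and integral_gibbs: "(\<integral>u. f u \<partial>gibbs_measure \<beta> h \<mu>) = (\<integral>u. f u * exp (- \<beta> * h u) \<partial>\<mu>) / Z"
    if [measurable]: "f \<in> borel_measurable borel" for f :: "'k \<Rightarrow> real"
  proof -
    have eq: "g u *\<^sub>R f u = (1 / Z) * (f u * exp (- \<beta> * h u))" for u by (simp add: g_def)
    have "integrable (gibbs_measure \<beta> h \<mu>) f \<longleftrightarrow> integrable \<mu> (\<lambda>u. g u *\<^sub>R f u)"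
      unfolding gibbs by (subst integrable_density) (simp_all add: g0)
    then show "integrable (gibbs_measure \<beta> h \<mu>) f \<longleftrightarrow> integrable \<mu> (\<lambda>u. f u * exp (- \<beta> * h u))"
      unfolding eq integrable_mult_left_iff using Z by simp
    have "(\<integral>u. f u \<partial>gibbs_measure \<beta> h \<mu>) = (\<integral>u. g u *\<^sub>R f u \<partial>\<mu>)"
      unfolding gibbs by (subst integral_density) (simp_all add: g0)
    then show "(\<integral>u. f u \<partial>gibbs_measure \<beta> h \<mu>) = (\<integral>u. f u * exp (- \<beta> * h u) \<partial>\<mu>) / Z"
      unfolding eq by simp
  qed
  have int_bounded: "integrable \<mu> (\<lambda>u. f u * exp (- \<beta> * h u))"
    if [measurable]: "f \<in> borel_measurable borel" and f: "bounded (range f)" for f :: "'k \<Rightarrow> real"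
  proof -
    obtain B where B: "\<And>u. \<bar>f u\<bar> \<le> B" using f by (auto simp: bounded_iff)
    show ?thesis
    proof (rule Bochner_Integration.integrable_bound)
      show "integrable \<mu> (\<lambda>u. B * exp (- \<beta> * h u))" using int_exp by simp
      show "AE u in \<mu>. norm (f u * exp (- \<beta> * h u)) \<le> norm (B * exp (- \<beta> * h u))"
        using order_trans[OF B abs_ge_self] by (auto simp: abs_mult)
    qed simp
  qed
  obtain hs where hs: "\<And>n. hs n \<in> Cc_cyl \<iota> e" "Lp_tendsto 2 \<mu> hs h"
    "Lp_tendsto 2 \<mu> (\<lambda>n. cyl_grad \<iota> e (hs n)) Dh"
    using Dh unfolding malliavin_deriv_def by blast
  have C1: "G.cylinder_C1 p F (pd p F)" if F: "F \<in> Cc_cyl \<iota> e" for p F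
  proof -
    obtain n \<phi> where \<phi>: "\<phi> \<in> Cc_infinity (2 * n)" and F_eq: "F = \<phi> \<circ> cyl_proj \<iota> e n"
      using F by (auto simp: Cc_cyl_def)
    have "F u = F v" if "\<forall>q\<in>{..<n} \<times> UNIV. X q u = X q v" for u v
    proof -
      have "cyl_proj \<iota> e n u = cyl_proj \<iota> e n v" using that by (auto simp: cyl_proj_eq fun_eq_iff)
      then show ?thesis by (simp add: F_eq)
    qed
    moreover have "finite ({..<n} \<times> (UNIV :: bool set))" by simp
    moreover have "((\<lambda>t. F (u + t *\<^sub>R \<iota> (b p))) has_real_derivative pd p F u) (at 0)" for u
      unfolding F_eq by (rule pd_cylinder(2)[OF \<phi>])
    ultimately show ?thesis
      unfolding G.cylinder_C1_def
      using continuous_Cc_cyl[OF F] continuous_Cc_cyl[OF pd_in_Cc_cyl[OF F]]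
        bounded_Cc_cyl[OF F] bounded_Cc_cyl[OF pd_in_Cc_cyl[OF F]] by blast
  qed
  have meas: "F \<in> borel_measurable borel" if "F \<in> Cc_cyl \<iota> e" for F
    by (intro borel_measurable_continuous_onI continuous_Cc_cyl that)
  let ?E = "\<lambda>f. \<integral>u. f u * exp (- \<beta> * h u) \<partial>\<mu>"
  show ?thesis
    unfolding KMS_state_def
  proof (intro conjI ballI)
    have "emeasure (density \<mu> (\<lambda>u. ennreal (g u))) (space (density \<mu> (\<lambda>u. ennreal (g u)))) = 1"
    proof -
      have "(\<integral>\<^sup>+u. ennreal (g u) \<partial>\<mu>) = ennreal (\<integral>u. g u \<partial>\<mu>)"
        using g0 int_exp by (intro nn_integral_eq_integral) (auto simp: g_def)
      also have "(\<integral>u. g u \<partial>\<mu>) = 1"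
        using Z unfolding g_def integral_divide_zero Z_def[symmetric] by simp
      finally show ?thesis by (simp add: emeasure_density cong: nn_integral_cong)
    qed
    then show "prob_space (gibbs_measure \<beta> h \<mu>)"
      unfolding gibbs by (rule prob_spaceI)
    show "sets (gibbs_measure \<beta> h \<mu>) = sets borel"
      by (simp add: gibbs G.sets_M)
    fix F G assume F: "F \<in> Cc_cyl \<iota> e" and G: "G \<in> Cc_cyl \<iota> e"
    obtain nF nG where nF: "\<forall>j t u. nF \<le> j \<longrightarrow> pd (j, t) F u = 0"
      and nG: "\<forall>j t u. nG \<le> j \<longrightarrow> pd (j, t) G u = 0"
      using eventually_pd_zero[OF F] eventually_pd_zero[OF G] by metis
    \<comment> \<open>One truncation for all the series, so that they can be compared term by
      term.\<close>
    define n where "n = max nF nG"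
    have n: "pd (j, t) F u = 0" "pd (j, t) G u = 0" if "n \<le> j" for j t u
      using nF nG that by (auto simp: n_def)
    have [measurable]: "F \<in> borel_measurable borel" "G \<in> borel_measurable borel"
      "pd p F \<in> borel_measurable borel" "pd p G \<in> borel_measurable borel" for p
      using F G meas pd_in_Cc_cyl by blast+
    have poisson_eq: "poisson \<iota> e F G = (\<lambda>u. \<Sum>j<n. pd (j, False) F u * pd (j, True) G u - pd (j, False) G u * pd (j, True) F u)"
      unfolding poisson_def de_eq df_eq by (intro ext suminf_eq_sum_lessThan) (simp add: n)
    have free_eq: "free_term \<iota> e lam F = (\<lambda>u. \<Sum>j<n. lam j * (pd (j, False) F u * X (j, True) u - pd (j, True) F u * X (j, False) u))"
      unfolding free_term_def de_eq df_eq pairing_e pairing_f by (intro ext suminf_eq_sum_lessThan) (simp add: n)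
    have inter_eq: "interaction_term \<iota> e Dh F = (\<lambda>u. \<Sum>j<n. pd (j, False) F u * X (j, True) (Dh u) - pd (j, True) F u * X (j, False) (Dh u))"
      unfolding interaction_term_def de_eq df_eq pairing_e pairing_f by (intro ext suminf_eq_sum_lessThan) (simp add: n)
    have bd: "bounded (range (\<lambda>u. pd p F u * pd q G u))" "bounded (range (\<lambda>u. pd p G u * pd q F u))"
      "bounded (range (\<lambda>u. pd p (pd q F) u * G u))" for p q
      by (intro bounded_range_mult bounded_Cc_cyl pd_in_Cc_cyl F G)+
    have bd_X: "bounded (range (\<lambda>u. X q u * (pd p F u * G u)))" if "fst q = fst p" for p q
      using bounded_range_mult[OF bounded_X_pd[OF F that] bounded_Cc_cyl[OF G]] by (simp add: mult.assoc)
    \<comment> \<open>The coordinate of \<open>Dh\<close> need not be bounded; its weighted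
      integrability is the hypothesis \<open>int_Dh\<close> for the test vector
      \<open>b q\<close>.\<close>
    have int_pd_Dh: "integrable \<mu> (\<lambda>u. pd p F u * G u * X q (Dh u) * exp (- \<beta> * h u))" for p q
    proof -
      have "bounded (range (\<lambda>u. pd p F u * G u))"
        by (intro bounded_range_mult bounded_Cc_cyl pd_in_Cc_cyl F G)
      then obtain B where B: "\<And>u. \<bar>pd p F u * G u\<bar> \<le> B"
        by (auto simp: bounded_iff)
      show ?thesis
      proof (rule Bochner_Integration.integrable_bound)
        show "integrable \<mu> (\<lambda>u. B * (X q (Dh u) * exp (- \<beta> * h u)))" using int_X_Dh by simp
        show "AE u in \<mu>. norm (pd p F u * G u * X q (Dh u) * exp (- \<beta> * h u)) \<le> norm (B * (X q (Dh u) * exp (- \<beta> * h u)))"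
          using order_trans[OF B abs_ge_self] unfolding mult.assoc[of "_ * G _"] real_norm_def abs_mult[of "_ * G _"] abs_mult[of B]
          by (intro AE_I2 mult_right_mono) auto
      qed simp
    qed
    \<comment> \<open>The condition on the indices provides the boundedness of
      \<open>X q u * (pd p F u * G u)\<close>. It holds below, where \<open>p\<close> and
      \<open>q\<close> differ only in their second components.\<close>
    have ibp: "?E (\<lambda>u. pd q (pd p F) u * G u) + ?E (\<lambda>u. pd p F u * pd q G u)
      = \<beta> * (lam (fst q) * ?E (\<lambda>u. X q u * (pd p F u * G u)) + ?E (\<lambda>u. pd p F u * G u * X q (Dh u)))"
      if pq: "fst q = fst p" for p q
    proof -
      have "(\<integral>u. (pd q (pd p F) u * G u + pd p F u * pd q G u) * exp (- \<beta> * h u) \<partial>\<mu>)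
        = \<beta> * lam (fst q) * (\<integral>u. X q u * (pd p F u * G u) * exp (- \<beta> * h u) \<partial>\<mu>)
          + \<beta> * (\<integral>u. pd p F u * G u * (X q (Dh u) * exp (- \<beta> * h u)) \<partial>\<mu>)"
      proof (rule G.integration_by_parts_exp)
        show "G.cylinder_C1 q (\<lambda>u. pd p F u * G u) (\<lambda>u. pd q (pd p F) u * G u + pd p F u * pd q G u)"
          by (intro G.cylinder_C1_mult C1 pd_in_Cc_cyl F G)
        show "bounded (range (\<lambda>u. X q u * (pd p F u * G u)))" by (rule bd_X[OF pq])
        show "G.cylinder_C1 q (hs n) (pd q (hs n))" for n by (rule C1[OF hs(1)])
        show "integrable \<mu> (\<lambda>u. (hs n u - h u)\<^sup>2)" for n
          using Lp_tendsto_2D(5)[OF hs(2), of n] by simp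
        show "(\<lambda>n. \<integral>u. (hs n u - h u)\<^sup>2 \<partial>\<mu>) \<longlonglongrightarrow> 0"
          using Lp_tendsto_2D(6)[OF hs(2)] by simp
        show "integrable \<mu> (\<lambda>u. (X q (Dh u))\<^sup>2)" by (rule Lp_tendsto_2_X(1)[OF hs(3)])
        show "integrable \<mu> (\<lambda>u. (pd q (hs n) u - X q (Dh u))\<^sup>2)" for n
          using Lp_tendsto_2_X(2)[OF hs(3), of q n] by (simp only: X_cyl_grad[OF hs(1)])
        show "(\<lambda>n. \<integral>u. (pd q (hs n) u - X q (Dh u))\<^sup>2 \<partial>\<mu>) \<longlonglongrightarrow> 0"
          using Lp_tendsto_2_X(3)[OF hs(3), of q] by (simp only: X_cyl_grad[OF hs(1)])
      qed (use \<open>\<beta> > 0\<close> int_exp int_X_Dh in auto)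
      moreover have "(\<integral>u. (pd q (pd p F) u * G u + pd p F u * pd q G u) * exp (- \<beta> * h u) \<partial>\<mu>)
          = ?E (\<lambda>u. pd q (pd p F) u * G u) + ?E (\<lambda>u. pd p F u * pd q G u)"
        using meas[OF pd_in_Cc_cyl[OF pd_in_Cc_cyl[OF F]]] unfolding distrib_right
        by (intro Bochner_Integration.integral_add int_bounded bd) simp_all
      ultimately show ?thesis by (simp add: distrib_left mult.assoc)
    qed
    have int_poisson_term: "integrable \<mu> (\<lambda>u. pd p F u * pd q G u * exp (- \<beta> * h u))"
      "integrable \<mu> (\<lambda>u. pd p G u * pd q F u * exp (- \<beta> * h u))" for p q
      by (intro int_bounded bd; simp)+
    have int_X: "integrable \<mu> (\<lambda>u. X q u * (pd p F u * G u) * exp (- \<beta> * h u))" if "fst q = fst p" for p q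
      by (intro int_bounded bd_X that) simp
    have poisson_meas: "poisson \<iota> e F G \<in> borel_measurable borel"
      unfolding poisson_eq by measurable
    have poisson_exp: "(\<lambda>u. poisson \<iota> e F G u * exp (- \<beta> * h u))
      = (\<lambda>u. \<Sum>j<n. pd (j, False) F u * pd (j, True) G u * exp (- \<beta> * h u) - pd (j, False) G u * pd (j, True) F u * exp (- \<beta> * h u))"
      unfolding poisson_eq by (simp add: sum_distrib_right left_diff_distrib)
    show "integrable (gibbs_measure \<beta> h \<mu>) (poisson \<iota> e F G)"
      unfolding integrable_gibbs[OF poisson_meas] poisson_exp
      by (intro Bochner_Integration.integrable_sum Bochner_Integration.integrable_diff int_poisson_term)
    let ?R = "\<lambda>u. (free_term \<iota> e lam F u + interaction_term \<iota> e Dh F u) * G u"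
    have R_meas: "?R \<in> borel_measurable borel"
      unfolding free_eq inter_eq by measurable
    have R_exp: "(\<lambda>u. ?R u * exp (- \<beta> * h u)) = (\<lambda>u. \<Sum>j<n.
        (lam j * (X (j, True) u * (pd (j, False) F u * G u) * exp (- \<beta> * h u))
          + pd (j, False) F u * G u * X (j, True) (Dh u) * exp (- \<beta> * h u))
        - (lam j * (X (j, False) u * (pd (j, True) F u * G u) * exp (- \<beta> * h u))
          + pd (j, True) F u * G u * X (j, False) (Dh u) * exp (- \<beta> * h u)))"
      unfolding free_eq inter_eq sum.distrib[symmetric] sum_distrib_right
      by (intro ext sum.cong refl) (simp add: algebra_simps)
    show "integrable (gibbs_measure \<beta> h \<mu>) ?R"
      unfolding integrable_gibbs[OF R_meas] R_exp
      by (intro Bochner_Integration.integrable_sum Bochner_Integration.integrable_diff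
          Bochner_Integration.integrable_add integrable_mult_right int_X int_pd_Dh) simp_all
    have "?E (poisson \<iota> e F G) = (\<Sum>j<n. ?E (\<lambda>u. pd (j, False) F u * pd (j, True) G u) - ?E (\<lambda>u. pd (j, False) G u * pd (j, True) F u))"
      unfolding poisson_exp
      by (subst Bochner_Integration.integral_sum, intro Bochner_Integration.integrable_diff int_poisson_term)
        (intro sum.cong refl Bochner_Integration.integral_diff int_poisson_term)
    also have "\<dots> = (\<Sum>j<n. \<beta> * ((lam j * ?E (\<lambda>u. X (j, True) u * (pd (j, False) F u * G u))
          + ?E (\<lambda>u. pd (j, False) F u * G u * X (j, True) (Dh u)))
        - (lam j * ?E (\<lambda>u. X (j, False) u * (pd (j, True) F u * G u))
          + ?E (\<lambda>u. pd (j, True) F u * G u * X (j, False) (Dh u)))))"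
    proof (rule sum.cong[OF refl])
      fix j
      have "?E (\<lambda>u. pd (j, False) G u * pd (j, True) F u) = ?E (\<lambda>u. pd (j, True) F u * pd (j, False) G u)"
        by (simp only: mult.commute)
      \<comment> \<open>The two instances of \<open>ibp\<close> have the roles of \<open>p\<close>
        and \<open>q\<close> exchanged, so each supplies one half of the bracket;
        \<open>pd_commute\<close> identifies the remaining terms on their left sides.\<close>
      then show "?E (\<lambda>u. pd (j, False) F u * pd (j, True) G u) - ?E (\<lambda>u. pd (j, False) G u * pd (j, True) F u)
        = \<beta> * ((lam j * ?E (\<lambda>u. X (j, True) u * (pd (j, False) F u * G u))
          + ?E (\<lambda>u. pd (j, False) F u * G u * X (j, True) (Dh u)))
        - (lam j * ?E (\<lambda>u. X (j, False) u * (pd (j, True) F u * G u))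
          + ?E (\<lambda>u. pd (j, True) F u * G u * X (j, False) (Dh u))))"
        using ibp[of "(j, True)" "(j, False)"] ibp[of "(j, False)" "(j, True)"]
        unfolding pd_commute[OF F, of "(j, True)" "(j, False)"] right_diff_distrib fst_conv
        by linarith
    qed
    also have "\<dots> = \<beta> * ?E ?R"
    proof -
      have linear: "(\<integral>u. (l * f1 u + f2 u) - (l * f3 u + f4 u) \<partial>\<mu>)
          = (l * (\<integral>u. f1 u \<partial>\<mu>) + (\<integral>u. f2 u \<partial>\<mu>)) - (l * (\<integral>u. f3 u \<partial>\<mu>) + (\<integral>u. f4 u \<partial>\<mu>))"
        if "integrable \<mu> f1" "integrable \<mu> f2" "integrable \<mu> f3" "integrable \<mu> f4"
        for l and f1 f2 f3 f4 :: "'k \<Rightarrow> real"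
        using that by simp
      show ?thesis
        unfolding R_exp sum_distrib_left[symmetric]
        by (subst Bochner_Integration.integral_sum, intro Bochner_Integration.integrable_diff
            Bochner_Integration.integrable_add integrable_mult_right int_X int_pd_Dh, simp, simp)
          (intro arg_cong2[where f = "(*)"] refl sum.cong linear[symmetric] int_X int_pd_Dh, simp_all)
    qed
    finally show "(\<integral>u. poisson \<iota> e F G u \<partial>gibbs_measure \<beta> h \<mu>) = \<beta> * (\<integral>u. ?R u \<partial>gibbs_measure \<beta> h \<mu>)"
      unfolding integral_gibbs[OF poisson_meas] integral_gibbs[OF R_meas] by simp
  qed
qed

end

theorem theorem4p11:
  fixes D :: "'h::separable_chilbert set"
    and A :: "'h \<Rightarrow> 'h"
    and e :: "nat \<Rightarrow> 'h"
    and lam :: "nat \<Rightarrow> real"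
    and c s \<beta> :: real
    and \<iota> :: "'h \<Rightarrow> 'k::separable_chilbert"
    and \<mu>0 :: "'k measure"
    and h :: "'k \<Rightarrow> real"
    and Dh :: "'k \<Rightarrow> 'k"
  assumes "self_adjoint D A"
    and "c > 0" and "bounded_below D A c"
    and "compact_resolvent D A"
    and "orthonormal_basis e"
    and "\<forall>j. e j \<in> D \<and> A (e j) = lam j *\<^sub>R e j"
    and "s \<ge> 0" and "summable (\<lambda>j. lam j powr (- (1 + s)))"
    and "neg_sobolev_completion e lam s \<iota>"
    and "\<beta> > 0"
    and "gaussian_measure D A e lam s \<iota> \<beta> \<mu>0"
    and "h \<in> borel_measurable borel"
    and "integrable \<mu>0 (\<lambda>u. exp (- \<beta> * h u))"
    and "h \<in> malliavin_sobolev \<iota> e 2 \<mu>0"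
    and "malliavin_deriv \<iota> e 2 \<mu>0 h Dh"
    and "\<forall>w\<in>sobolev e lam s. integrable \<mu>0 (\<lambda>u. pairing \<iota> (Dh u) w * exp (- \<beta> * h u))"
  shows "KMS_state \<iota> e lam \<beta> Dh (gibbs_measure \<beta> h \<mu>0)"
proof -
  \<comment> \<open>The lower bound for \<open>A\<close> is tested on the unit eigenvector
    \<open>e j\<close>.\<close>
  have "c \<le> lam j" for j
  proof -
    have "inner (e j) (e j) = 1"
      using assms(5) by (simp add: orthonormal_basis_def inner_eq_Re_cinner)
    then show ?thesis
      using assms(3,6) unfolding bounded_below_def by (metis inner_scaleR_right mult.right_neutral)
  qed
  then interpret eigenbasis_completion e lam c s \<iota>
    using assms by unfold_locales auto
  show ?thesis
    using assms by (intro gibbs_measure_KMS) auto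
qed

end
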